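(* Let $F:\mathbb{R}^n\times\mathbb{R}^m\to\mathbb{R}$ be continuously differentiable and let $\mathcal S\subset\operatorname{Saddle}(F)$ be a $p$-dimensional submanifold of saddle points. Assume that $F$ is $\mathcal C^1$ with locally Lipschitz gradient on a neighborhood of $\mathcal S$ and that the vector field $X_{\text{sp}}$ of the saddle-point dynamics of $F$ is piecewise $\mathcal C^2$. Assume that at each $(x_*,z_* )\in\mathcal S$, the set of matrices $\mathcal A_*\subset\mathbb{R}^{(n+m)\times(n+m)}$ defined as $$\mathcal A_*=\Big\{\lim_{k\to\infty}DX_{\text{sp}}(x_k,z_k)\;\Big|\;(x_k,z_k)\to(x_*,z_* ),\ (x_k,z_k)\in\mathbb{R}^{n+m}\setminus\Omega_{X_{\text{sp}}}\Big\},$$ where $\Omega_{X_{\text{sp}}}$ is the set of points where $X_{\text{sp}}$ is not differentiable, satisfies the following: (i) there exists an orthogonal matrix $Q\in\mathbb{R}^{(n+m)\times(n+m)}$ such that for all $A\in\mathcal A_*$ $$Q^\top AQ=\begin{bmatrix}0&0\\0&\tilde A\end{bmatrix},\qquad \tilde A\in\mathbb{R}^{(n+m-p)\times(n+m-p)};$$ (ii) the nonzero eigenvalues of the matrices in $\mathcal A_*$ have negative real parts; (iii) there exists a positive definite matrix $P\in\mathbb{R}^{(n+m-p)\times(n+m-p)}$ such that $\tilde A^\top P+P\tilde A\prec0$ for all $\tilde A$ obtained by applying the transformation in (i) to each $A\in\mathcal A_*$. Then $\mathcal S$ is locally asymptotically stable under the saddle-point dynamics $X_{\text{sp}}$ and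 the trajectories converge to a point in $\mathcal S$.
   Context: Saddle-point dynamics: for a continuously differentiable $F:\mathbb{R}^n\times\mathbb{R}^m\to\mathbb{R}$ it is $\dot x=-\nabla_xF(x,z)$, $\dot z=\nabla_zF(x,z)$, with vector field denoted $X_{\text{sp}}:\mathbb{R}^{n+m}\to\mathbb{R}^{n+m}$. $D$ denotes the Jacobian. Saddle points: $(x_*,z_* )$ is a (local min-max) saddle point of $F$ if there are open neighborhoods $\mathcal U_{x_*}\subset\mathbb{R}^n$ of $x_*$ and $\mathcal U_{z_*}\subset\mathbb{R}^m$ of $z_*$ with $F(x_*,z)\le F(x_*,z_* )\le F(x,z_* )$ for all $z\in\mathcal U_{z_*}$, $x\in\mathcal U_{x_*}$. $\operatorname{Saddle}(F)$ is the set of all such points. Piecewise $\mathcal C^2$: a vector field $f:\mathbb{R}^N\to\mathbb{R}^N$ is piecewise $\mathcal C^2$ if it is continuous and there exist (1) a finite collection of disjoint open sets (patches) $\mathcal D_1,\dots,\mathcal D_r\subset\mathbb{R}^N$ with $\mathbb{R}^N=\bigcup_i\mathrm{cl}(\mathcal D_i)$ and (2) $\mathcal C^2$ functions $f_i:\mathcal D_i^e\to\mathbb{R}^N$, with $\mathcal D_i^e$ open and $\mathrm{cl}(\mathcal D_i)\subset\mathcal D_i^e$, such that $f$ and $f_i$ coincide on $\mathrm{cl}(\mathcal D_i)$ for each $i$. $M\prec0$ means $M$ is negative definite. Stability: a set $\mathcal S$ of equilibria is locally asymptotically stable if (a) for every $\epsilon>0$ there is an open set $W\supset\mathcal S$ such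 that every trajectory starting in $W$ stays within distance less than $\epsilon$ of $\mathcal S$ for all $t\ge0$, and (b) there is an open set $W\supset\mathcal S$ such that the distance to $\mathcal S$ of every trajectory starting in $W$ tends to $0$ as $t\to\infty$. "The trajectories converge to a point in $\mathcal S$" means that the trajectories starting in some open set containing $\mathcal S$ each converge to a single point of $\mathcal S$. *)

theory Defs
  imports "HOL-Analysis.Analysis" "Jordan_Normal_Form.Char_Poly"
begin

section \<open>Differentiability classes\<close>

definition C1_on :: "('a::real_normed_vector \<Rightarrow> 'b::real_normed_vector) \<Rightarrow> 'a set \<Rightarrow> bool" where
  "C1_on f U \<longleftrightarrow> (\<exists>f' :: 'a \<Rightarrow> 'a \<Rightarrow>\<^sub>L 'b.
     (\<forall>x\<in>U. (f has_derivative blinfun_apply (f' x)) (at x)) \<and> continuous_on U f')"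

definition C2_on :: "('a::real_normed_vector \<Rightarrow> 'b::real_normed_vector) \<Rightarrow> 'a set \<Rightarrow> bool" where
  "C2_on f U \<longleftrightarrow> (\<exists>f' :: 'a \<Rightarrow> 'a \<Rightarrow>\<^sub>L 'b.
     (\<forall>x\<in>U. (f has_derivative blinfun_apply (f' x)) (at x)) \<and> C1_on f' U)"

definition piecewise_C2 :: "('a::euclidean_space \<Rightarrow> 'a) \<Rightarrow> bool" where
  "piecewise_C2 f \<longleftrightarrow> continuous_on UNIV f \<and>
     (\<exists>(r::nat) (D :: nat \<Rightarrow> 'a set) (De :: nat \<Rightarrow> 'a set) (g :: nat \<Rightarrow> 'a \<Rightarrow> 'a).
        (\<forall>i<r. open (D i)) \<and> disjoint_family_on D {..<r} \<and>
        (\<Union>i<r. closure (D i)) = UNIV \<and>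
        (\<forall>i<r. open (De i) \<and> closure (D i) \<subseteq> De i \<and> C2_on (g i) (De i) \<and>
               (\<forall>y\<in>closure (D i). f y = g i y)))"

text \<open>Embedded submanifolds, through flattening charts of the ambient space. Only
  \<open>C\<^sup>1\<close> regularity is asked of the charts, so submanifolds of any higher regularity are
  included.\<close>

definition submanifold_dim :: "nat \<Rightarrow> 'a::euclidean_space set \<Rightarrow> bool" where
  "submanifold_dim p S \<longleftrightarrow> (\<forall>s\<in>S. \<exists>U V \<phi> \<psi> T.
     open U \<and> s \<in> U \<and> open V \<and> homeomorphism U V \<phi> \<psi> \<and> C1_on \<phi> U \<and> C1_on \<psi> V \<and>
     subspace (T :: 'a set) \<and> dim T = p \<and> \<phi> ` (U \<inter> S) = V \<inter> T)"

section \<open>Saddle points and saddle-point dynamics\<close>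

definition grad :: "('a::real_inner \<Rightarrow> real) \<Rightarrow> 'a \<Rightarrow> 'a" where
  "grad f x = (THE D. GDERIV f x :> D)"

text \<open>The space \<open>\<real>\<^sup>n\<^sup>+\<^sup>m\<close> is rendered as the Euclidean space \<open>\<real>\<^sup>n \<times> \<real>\<^sup>m\<close>.\<close>

definition Xsp :: "('a::real_inner \<times> 'b::real_inner \<Rightarrow> real) \<Rightarrow> 'a \<times> 'b \<Rightarrow> 'a \<times> 'b" where
  "Xsp F = (\<lambda>(x, z). (- grad (\<lambda>x'. F (x', z)) x, grad (\<lambda>z'. F (x, z')) z))"

definition Saddle :: "('a::topological_space \<times> 'b::topological_space \<Rightarrow> real) \<Rightarrow> ('a \<times> 'b) set" where
  "Saddle F = {(xs, zs). \<exists>U V. open U \<and> xs \<in> U \<and> open V \<and> zs \<in> V \<and>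
     (\<forall>z\<in>V. \<forall>x\<in>U. F (xs, z) \<le> F (xs, zs) \<and> F (xs, zs) \<le> F (x, zs))}"

section \<open>Jacobian matrices and their limits\<close>

text \<open>Jacobians are square matrices of size \<open>DIM('a)\<close>, with respect to the standard basis in the
  fixed enumeration \<open>from_nat_into Basis\<close>. The library does not say which enumeration this is;
  another one conjugates all Jacobians by one permutation matrix.\<close>

definition Jacobian :: "('a::euclidean_space \<Rightarrow> 'a) \<Rightarrow> 'a \<Rightarrow> real mat" where
  "Jacobian f y = Matrix.mat DIM('a) DIM('a)
     (\<lambda>(i, j). inner (from_nat_into Basis i) (frechet_derivative f (at y) (from_nat_into Basis j)))"

definition nondiff_points :: "('a::euclidean_space \<Rightarrow> 'a) \<Rightarrow> 'a set" where
  "nondiff_points f = {y. \<not> f differentiable (at y)}"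

text \<open>The type of matrices carries no topology; limits of matrices are taken entrywise.\<close>

definition Jacobian_limits :: "('a::euclidean_space \<Rightarrow> 'a) \<Rightarrow> 'a \<Rightarrow> real mat set" where
  "Jacobian_limits f y = {A \<in> carrier_mat DIM('a) DIM('a).
     \<exists>ys :: nat \<Rightarrow> 'a. ys \<longlonglongrightarrow> y \<and> (\<forall>k. ys k \<in> UNIV - nondiff_points f) \<and>
       (\<forall>i<DIM('a). \<forall>j<DIM('a). (\<lambda>k. Jacobian f (ys k) $$ (i, j)) \<longlonglongrightarrow> A $$ (i, j))}"

section \<open>Matrices\<close>

text \<open>The library predicate \<^const>\<open>orthogonal_mat\<close> only asks for nonzero, pairwise orthogonal
  columns; here the columns are orthonormal.\<close>

definition orthonormal_mat :: "nat \<Rightarrow> real mat \<Rightarrow> bool" where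
  "orthonormal_mat k Q \<longleftrightarrow> Q \<in> carrier_mat k k \<and> transpose_mat Q * Q = 1\<^sub>m k"

definition pos_def_mat :: "nat \<Rightarrow> real mat \<Rightarrow> bool" where
  "pos_def_mat k M \<longleftrightarrow> M \<in> carrier_mat k k \<and> transpose_mat M = M \<and>
     (\<forall>v\<in>carrier_vec k. v \<noteq> 0\<^sub>v k \<longrightarrow> scalar_prod v (M *\<^sub>v v) > 0)"

definition neg_def_mat :: "nat \<Rightarrow> real mat \<Rightarrow> bool" where
  "neg_def_mat k M \<longleftrightarrow> M \<in> carrier_mat k k \<and> transpose_mat M = M \<and>
     (\<forall>v\<in>carrier_vec k. v \<noteq> 0\<^sub>v k \<longrightarrow> scalar_prod v (M *\<^sub>v v) < 0)"

definition zero_block :: "nat \<Rightarrow> nat \<Rightarrow> real mat \<Rightarrow> real mat" where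
  "zero_block p q B = four_block_mat (0\<^sub>m p p) (0\<^sub>m p q) (0\<^sub>m q p) B"

section \<open>Trajectories and stability\<close>

definition solution_on :: "('a::real_normed_vector \<Rightarrow> 'a) \<Rightarrow> ereal \<Rightarrow> (real \<Rightarrow> 'a) \<Rightarrow> bool" where
  "solution_on f T \<gamma> \<longleftrightarrow> 0 < T \<and>
     (\<forall>t. 0 \<le> t \<and> ereal t < T \<longrightarrow>
        (\<gamma> has_vector_derivative f (\<gamma> t)) (at t within {s. 0 \<le> s \<and> ereal s < T}))"

text \<open>A trajectory is a forward solution on \<open>[0, T)\<close>, with \<open>T\<close> possibly infinite, that cannot be
  continued to a larger interval. The value of \<open>\<gamma>\<close> outside \<open>[0, T)\<close> is irrelevant. A claim about
  trajectories at all times \<open>t \<ge> 0\<close> therefore includes \<open>T = \<infinity>\<close>.\<close>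

definition trajectory :: "('a::real_normed_vector \<Rightarrow> 'a) \<Rightarrow> ereal \<Rightarrow> (real \<Rightarrow> 'a) \<Rightarrow> bool" where
  "trajectory f T \<gamma> \<longleftrightarrow> solution_on f T \<gamma> \<and>
     \<not> (\<exists>T' \<gamma>'. T < T' \<and> solution_on f T' \<gamma>' \<and> (\<forall>t. 0 \<le> t \<and> ereal t < T \<longrightarrow> \<gamma>' t = \<gamma> t))"

definition locally_asymptotically_stable :: "('a::real_normed_vector \<Rightarrow> 'a) \<Rightarrow> 'a set \<Rightarrow> bool" where
  "locally_asymptotically_stable f S \<longleftrightarrow>
     (\<forall>s\<in>S. f s = 0) \<and>
     (\<forall>\<epsilon>>0. \<exists>W. open W \<and> S \<subseteq> W \<and>
        (\<forall>T \<gamma>. trajectory f T \<gamma> \<and> \<gamma> 0 \<in> W \<longrightarrow> T = \<infinity> \<and> (\<forall>t\<ge>0. infdist (\<gamma> t) S < \<epsilon>))) \<and>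
     (\<exists>W. open W \<and> S \<subseteq> W \<and>
        (\<forall>T \<gamma>. trajectory f T \<gamma> \<and> \<gamma> 0 \<in> W \<longrightarrow>
           T = \<infinity> \<and> ((\<lambda>t. infdist (\<gamma> t) S) \<longlongrightarrow> 0) at_top))"

definition trajectories_converge_to_point_in :: "('a::real_normed_vector \<Rightarrow> 'a) \<Rightarrow> 'a set \<Rightarrow> bool" where
  "trajectories_converge_to_point_in f S \<longleftrightarrow>
     (\<exists>W. open W \<and> S \<subseteq> W \<and>
        (\<forall>T \<gamma>. trajectory f T \<gamma> \<and> \<gamma> 0 \<in> W \<longrightarrow> T = \<infinity> \<and> (\<exists>s\<in>S. (\<gamma> \<longlongrightarrow> s) at_top)))"

end

theory Submission
  imports Defs
begin

text \<open>Near \<open>s \<in> S\<close> every increment \<open>f x - f y\<close> of a piecewise \<open>C\<^sup>2\<close> field is, tested against any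
  vector, dominated up to an arbitrarily small relative error by \<open>A (x - y)\<close> for one of the finitely
  many patch derivatives \<open>A\<close> at \<open>s\<close>, and each of these belongs to \<open>\<A>\<^sub>*\<close>. The common form of the
  matrices in \<open>\<A>\<^sub>*\<close> gives a subspace \<open>E\<close> of dimension \<open>p\<close> on which all of them vanish and an inner product
  \<open>\<langle>G _, _\<rangle>\<close>, equal to \<open>P\<close> on the complement of \<open>E\<close>, with \<open>\<langle>G w, A w\<rangle> < 0\<close> on that complement.
  Since \<open>f = 0\<close> on \<open>S\<close>, the tangent spaces of \<open>S\<close> near \<open>s\<close> lie in a thin cone around \<open>E\<close>, and having the same
  dimension they are close to \<open>E\<close>. So if \<open>s'\<close> is a \<open>G\<close>-nearest point of \<open>S\<close> to \<open>x\<close>, then \<open>x - s'\<close> is almost in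
  the complement of \<open>E\<close> and \<open>\<langle>G (x - s'), f x\<rangle> \<le> - c \<parallel>x - s'\<parallel>\<^sup>2\<close>, while \<open>\<parallel>f x\<parallel> \<le> L \<parallel>x - s'\<parallel>\<close>. Hence
  the \<open>G\<close>-distance to \<open>S\<close> decreases at least proportionally to the distance travelled: trajectories
  have finite length, stay near \<open>s\<close>, and converge to an equilibrium, which must lie in \<open>S\<close>.\<close>

section \<open>One-sided growth bounds and the distance to a set of equilibria\<close>

text \<open>Continuous induction: the times at which \<open>u t - K * t\<close> is at most its
  initial value form a closed set. Its supremum belongs to it, and the local bound would carry a
  supremum below \<open>b\<close> further to the right. No differentiability is asked, so
  \<open>u\<close> may be an infimum or be patched from smooth pieces.\<close>

lemma right_local_growth_bound:
  fixes u :: "real \<Rightarrow> real"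
  assumes ab: "a \<le> b" and cont: "continuous_on {a..b} u"
    and loc: "\<And>t. a \<le> t \<Longrightarrow> t < b \<Longrightarrow>
      \<exists>d>0. \<forall>t'. t < t' \<and> t' < t + d \<and> t' \<le> b \<longrightarrow> u t' \<le> u t + K * (t' - t)"
  shows "u b \<le> u a + K * (b - a)"
proof -
  define v where "v t = u t - K * t" for t
  define A where "A = {t \<in> {a..b}. v t \<le> v a}"
  have "continuous_on {a..b} v"
    unfolding v_def by (intro continuous_intros cont)
  then have cA: "closed A"
    unfolding A_def by (intro closed_Collect_le continuous_on_closed_Collect_le continuous_intros) auto
  have aA: "a \<in> A" using ab by (auto simp: A_def)
  have bd: "bdd_above A" by (auto simp: A_def intro: bdd_aboveI[of _ b])
  define m where "m = Sup A"
  have mA: "m \<in> A"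
    unfolding m_def using closed_contains_Sup[OF _ bd cA] aA by blast
  have "m = b"
  proof (rule ccontr)
    assume "m \<noteq> b"
    with mA have m: "a \<le> m" "m < b" "v m \<le> v a" by (auto simp: A_def)
    obtain d where d: "d > 0"
      "\<And>t'. m < t' \<Longrightarrow> t' < m + d \<Longrightarrow> t' \<le> b \<Longrightarrow> u t' \<le> u m + K * (t' - m)"
      using loc[OF m(1,2)] by blast
    define t' where "t' = min (m + d / 2) b"
    have t': "m < t'" "t' < m + d" "t' \<le> b" using d(1) m by (auto simp: t'_def)
    have "v t' \<le> v m" using d(2)[OF t'] by (simp add: v_def algebra_simps)
    then have "t' \<in> A" using m t' by (auto simp: A_def)
    then have "t' \<le> m" unfolding m_def using bd by (rule cSup_upper)
    with t' show False by simp
  qed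
  with mA show ?thesis by (simp add: A_def v_def algebra_simps)
qed

text \<open>The hypothesis for all \<open>e > 0\<close> says that the upper right Dini derivative of
  \<open>u\<close> is at most 0; the total growth is then at most any positive number.\<close>

lemma right_local_decreasing:
  fixes u :: "real \<Rightarrow> real"
  assumes ab: "a \<le> b" and cont: "continuous_on {a..b} u"
    and loc: "\<And>t e. a \<le> t \<Longrightarrow> t < b \<Longrightarrow> e > 0 \<Longrightarrow>
      \<exists>d>0. \<forall>t'. t < t' \<and> t' < t + d \<and> t' \<le> b \<longrightarrow> u t' \<le> u t + e * (t' - t)"
  shows "u b \<le> u a"
proof (rule field_le_epsilon)
  fix e :: real assume e: "e > 0"
  \<comment> \<open>A slope with total growth at most \<open>e\<close> over the interval; the
    \<open>+ 1\<close> covers \<open>a = b\<close>.\<close>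
  have "u b \<le> u a + e / (b - a + 1) * (b - a)"
    by (rule right_local_growth_bound[OF ab cont], rule loc) (use e ab in auto)
  also have "e / (b - a + 1) * (b - a) \<le> e"
    using e ab by (simp add: field_simps mult_nonneg_nonneg)
  finally show "u b \<le> u a + e" by simp
qed

section \<open>Quadratic forms and the distances they induce\<close>

definition energy :: "('a::real_inner \<Rightarrow> 'a) \<Rightarrow> 'a \<Rightarrow> real" where
  "energy G v = inner (G v) v"

text \<open>For positive definite \<open>G\<close> this is the distance to \<open>K\<close> in the
  norm of the inner product given by \<open>G\<close>. The root is taken because the squared
  distance decreases at a rate quadratic in the distance, but its root at a linear rate, comparable
  to the speed of a trajectory.\<close>

definition energy_dist :: "('a::real_inner \<Rightarrow> 'a) \<Rightarrow> 'a set \<Rightarrow> 'a \<Rightarrow> real" where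
  "energy_dist G K x = sqrt (INF s\<in>K. energy G (x - s))"

locale energy_form =
  fixes G :: "'a::euclidean_space \<Rightarrow> 'a" and c0 C0 :: real
  assumes lin: "bounded_linear G"
    and sym: "\<And>v w. inner (G v) w = inner v (G w)"
    and c0: "c0 > 0" and lower: "\<And>v. c0 * (norm v)\<^sup>2 \<le> energy G v"
    and C0: "C0 > 0" and upper: "\<And>v. norm (G v) \<le> C0 * norm v"
begin

lemma energy_nonneg: "energy G v \<ge> 0"
  using lower[of v] c0 by (meson order_trans mult_nonneg_nonneg zero_le_power2 less_imp_le)

lemma energy_upper: "energy G v \<le> C0 * (norm v)\<^sup>2"
proof -
  have "energy G v \<le> norm (G v) * norm v" unfolding energy_def by (rule norm_cauchy_schwarz)
  also have "\<dots> \<le> C0 * norm v * norm v" by (intro mult_right_mono upper) auto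
  finally show ?thesis by (simp add: power2_eq_square mult.assoc)
qed

lemma sqrt_energy_upper: "sqrt (energy G v) \<le> sqrt C0 * norm v"
  using real_sqrt_le_mono[OF energy_upper[of v]] by (simp add: real_sqrt_mult)

lemma energy_pos: "v \<noteq> 0 \<Longrightarrow> energy G v > 0"
  using lower[of v] c0 by (smt (verit) mult_pos_pos zero_less_norm_iff zero_less_power)

lemma energy_diff: "energy G y - energy G x = inner (G (y - x)) (y + x)"
  using sym[of x y] by (simp add: energy_def linear_diff[OF bounded_linear.linear[OF lin]] inner_diff inner_add inner_commute)

lemma energy_has_derivative:
  assumes "(g has_vector_derivative g') (at t within X)"
  shows "((\<lambda>t. energy G (g t)) has_real_derivative 2 * inner (G (g t)) g') (at t within X)"
proof -
  have "((\<lambda>t. inner (G (g t)) (g t)) has_vector_derivative (inner (G (g t)) g' + inner (G g') (g t))) (at t within X)"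
    by (intro bounded_bilinear.has_vector_derivative[OF bounded_bilinear_inner]
        bounded_linear.has_vector_derivative[OF lin] assms)
  moreover have "inner (G (g t)) g' + inner (G g') (g t) = 2 * inner (G (g t)) g'"
    using sym[of g' "g t"] by (simp add: inner_commute)
  ultimately show ?thesis
    by (simp add: energy_def has_real_derivative_iff_has_vector_derivative)
qed

lemma energy_dist_minimizer:
  assumes "s \<in> K" "\<And>s'. s' \<in> K \<Longrightarrow> energy G (x - s) \<le> energy G (x - s')"
  shows "energy_dist G K x = sqrt (energy G (x - s))"
  unfolding energy_dist_def
  by (rule arg_cong[where f = sqrt], rule cInf_eq_minimum) (use assms in auto)

lemma energy_dist_le:
  assumes "s \<in> K" shows "energy_dist G K x \<le> sqrt (energy G (x - s))"
  unfolding energy_dist_def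
  by (intro real_sqrt_le_mono cINF_lower bdd_belowI2[of _ 0] energy_nonneg assms)

lemma energy_dist_nonneg: "K \<noteq> {} \<Longrightarrow> energy_dist G K x \<ge> 0"
  unfolding energy_dist_def by (auto intro!: cINF_greatest energy_nonneg)

text \<open>On a bounded set the functions \<open>energy G (x - s)\<close> with \<open>s\<close> in
  \<open>K\<close> share one Lipschitz constant, by the factorization in \<open>energy_diff\<close>,
  and their infimum inherits it.\<close>

lemma continuous_on_energy_dist:
  assumes K: "compact K" "K \<noteq> {}" and B: "bounded B"
  shows "continuous_on B (energy_dist G K)"
proof -
  obtain M where M: "\<And>x s. x \<in> B \<Longrightarrow> s \<in> K \<Longrightarrow> norm (x - s) \<le> M" and "M > 0"
  proof -
    have "bounded {x - s |x s. x \<in> B \<and> s \<in> K}"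
      using bounded_minus[OF B compact_imp_bounded[OF K(1)]] by (simp add: image_def Bex_def)
        (rule bounded_subset, blast+)
    then show ?thesis using that unfolding bounded_pos by blast
  qed
  define V where "V x = (INF s\<in>K. energy G (x - s))" for x
  have *: "V y \<le> V x + 2 * C0 * M * dist x y" if "x \<in> B" "y \<in> B" for x y
  proof -
    have "V y - 2 * C0 * M * dist x y \<le> energy G (x - s)" if s: "s \<in> K" for s
    proof -
      have "V y \<le> energy G (y - s)" unfolding V_def
        by (intro cINF_lower bdd_belowI2[of _ 0] energy_nonneg s)
      moreover have "energy G (y - s) - energy G (x - s) \<le> 2 * C0 * M * dist x y"
      proof -
        have "energy G (y - s) - energy G (x - s) = inner (G (y - x)) ((y - s) + (x - s))"
          using energy_diff[of "y - s" "x - s"] by simp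
        also have "\<dots> \<le> norm (G (y - x)) * norm ((y - s) + (x - s))" by (rule norm_cauchy_schwarz)
        also have "\<dots> \<le> (C0 * norm (y - x)) * (M + M)"
          by (intro mult_mono upper norm_triangle_mono M s that \<open>x \<in> B\<close> \<open>y \<in> B\<close>) (use C0 in auto)
        finally show ?thesis by (simp add: dist_norm norm_minus_commute algebra_simps)
      qed
      ultimately show ?thesis by simp
    qed
    then have "V y - 2 * C0 * M * dist x y \<le> V x"
      unfolding V_def[of x] by (intro cINF_greatest K) auto
    then show ?thesis by simp
  qed
  have "(2 * C0 * M)-lipschitz_on B V"
  proof (rule lipschitz_onI)
    fix x y assume "x \<in> B" "y \<in> B"
    with *[of x y] *[of y x] show "dist (V x) (V y) \<le> 2 * C0 * M * dist x y"
      by (simp add: dist_real_def abs_le_iff dist_commute)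
  qed (use C0 \<open>M > 0\<close> in auto)
  then have "continuous_on B V" by (rule lipschitz_on_continuous_on)
  then show ?thesis unfolding energy_dist_def V_def by (intro continuous_intros)
qed

end

text \<open>Each minimizer frozen in time gives an upper barrier for the distance, so its one-sided Dini
  derivative is bounded by the derivative of the distance to that fixed point.\<close>

lemma (in energy_form) energy_dist_decrease:
  assumes K: "compact K" "K \<noteq> {}" and B: "bounded B" and cL: "c > 0" "L > 0"
    and step: "\<And>x. x \<in> B \<Longrightarrow> \<exists>s\<in>K. (\<forall>s'\<in>K. energy G (x - s) \<le> energy G (x - s')) \<and>
        inner (G (x - s)) (f x) \<le> - c * (norm (x - s))\<^sup>2 \<and> norm (f x) \<le> L * norm (x - s)"
    and ab: "a \<le> b"
    and der: "\<And>t. t \<in> {a..b} \<Longrightarrow> (g has_vector_derivative f (g t)) (at t within {a..b})"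
    and gB: "\<And>t. t \<in> {a..b} \<Longrightarrow> g t \<in> B"
  shows "energy_dist G K (g b) + c / (L * sqrt C0) * norm (g b - g a) \<le> energy_dist G K (g a)"
proof -
  \<comment> \<open>Decrease of the distance per unit of length travelled: at Euclidean distance
    \<open>r\<close> from the minimizer the distance falls at rate at least
    \<open>c / sqrt C0 * r\<close>, while the speed is at most \<open>L * r\<close>.\<close>
  define k where "k = c / (L * sqrt C0)"
  have k: "k > 0" using cL C0 by (simp add: k_def)
  define u where "u t = energy_dist G K (g t) + k * norm (g t - g a)" for t
  have cg: "continuous_on {a..b} g"
    using der by (meson continuous_on_eq_continuous_within has_vector_derivative_continuous)
  have "u b \<le> u a"
  proof (rule right_local_decreasing[OF ab])
    show "continuous_on {a..b} u"
      unfolding u_def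
      by (intro continuous_intros cg continuous_on_compose2[OF continuous_on_energy_dist[OF K B]]) (use gB in auto)
  next
    fix t e :: real assume t: "a \<le> t" "t < b" and e: "e > 0"
    then have tab: "t \<in> {a..b}" by simp
    obtain s where s: "s \<in> K" "\<And>s'. s' \<in> K \<Longrightarrow> energy G (g t - s) \<le> energy G (g t - s')"
        "inner (G (g t - s)) (f (g t)) \<le> - c * (norm (g t - s))\<^sup>2" "norm (f (g t)) \<le> L * norm (g t - s)"
      using step[OF gB[OF tab]] by blast
    have Dt: "energy_dist G K (g t) = sqrt (energy G (g t - s))"
      by (rule energy_dist_minimizer) (use s in auto)
    \<comment> \<open>The error per unit of time will be \<open>(k + sqrt C0) * e'\<close> if
      \<open>g t\<close> lies in \<open>K\<close> and \<open>(1 + k) * e'\<close> otherwise; this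
      choice serves both.\<close>
    define e' where "e' = e / (1 + k + sqrt C0)"
    have e': "e' > 0" using e k C0 by (simp add: e'_def add_pos_nonneg)
    obtain d1 where d1: "d1 > 0" "\<And>t'. t' \<in> {a..b} \<Longrightarrow> \<bar>t' - t\<bar> < d1 \<Longrightarrow>
        norm (g t' - g t - (t' - t) *\<^sub>R f (g t)) \<le> e' * \<bar>t' - t\<bar>"
      using der[OF tab] e' unfolding has_vector_derivative_def has_derivative_within_alt real_norm_def by blast
    have gd: "norm (g t' - g t) \<le> (norm (f (g t)) + e') * (t' - t)"
      if "t' \<in> {a..b}" "t < t'" "t' < t + d1" for t'
    proof -
      have "norm (g t' - g t) \<le> norm ((t' - t) *\<^sub>R f (g t)) + norm (g t' - g t - (t' - t) *\<^sub>R f (g t))"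
        by (rule norm_triangle_sub)
      also have "\<dots> \<le> (t' - t) * norm (f (g t)) + e' * (t' - t)"
        using d1(2)[of t'] that by auto
      finally show ?thesis by (simp add: algebra_simps)
    qed
    have tri: "u t' \<le> energy_dist G K (g t') + k * norm (g t' - g t) + k * norm (g t - g a)" for t'
    proof -
      have "norm (g t' - g a) \<le> norm (g t' - g t) + norm (g t - g a)"
        by (metis diff_add_cancel add_diff_eq norm_triangle_ineq)
      then have "k * norm (g t' - g a) \<le> k * (norm (g t' - g t) + norm (g t - g a))"
        using k by (intro mult_left_mono) auto
      then show ?thesis unfolding u_def by (simp add: algebra_simps)
    qed
    show "\<exists>d>0. \<forall>t'. t < t' \<and> t' < t + d \<and> t' \<le> b \<longrightarrow> u t' \<le> u t + e * (t' - t)"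
    \<comment> \<open>At \<open>s\<close> the root of the energy is not differentiable, but there
      the field vanishes, so displacement and distance are both of order
      \<open>e' * (t' - t)\<close>.\<close>
    proof (cases "g t = s")
      case True
      then have f0: "f (g t) = 0" using s(4) by simp
      have "u t' \<le> u t + e * (t' - t)" if "t < t'" "t' < t + d1" "t' \<le> b" for t'
      proof -
        have gd': "norm (g t' - g t) \<le> e' * (t' - t)" using gd[of t'] that t f0 by simp
        have "energy_dist G K (g t') \<le> sqrt C0 * norm (g t' - g t)"
          using energy_dist_le[OF s(1), of "g t'"] sqrt_energy_upper[of "g t' - s"] True by simp
        then have "u t' \<le> (k + sqrt C0) * norm (g t' - g t) + k * norm (g t - g a)"
          using tri[of t'] by (simp add: algebra_simps)
        also have "(k + sqrt C0) * norm (g t' - g t) \<le> (1 + k + sqrt C0) * (e' * (t' - t))"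
          using k C0 by (intro mult_mono gd') auto
        also have "\<dots> = e * (t' - t)"
          using k C0 by (simp add: e'_def add_pos_nonneg add_nonneg_eq_0_iff)
        also have "k * norm (g t - g a) \<le> u t"
          using energy_dist_nonneg[OF K(2)] by (simp add: u_def)
        finally show ?thesis by simp
      qed
      with d1(1) show ?thesis by blast
    next
      case False
      define r where "r = norm (g t - s)"
      have r: "r > 0" using False by (simp add: r_def)
      define N where "N t' = sqrt (energy G (g t' - s))" for t'
      have Npos: "energy G (g t - s) > 0" using False by (intro energy_pos) simp
      have "((\<lambda>t'. g t' - s) has_vector_derivative f (g t)) (at t within {a..b})"
        using has_vector_derivative_diff[OF der[OF tab] has_vector_derivative_const[of s]] by simp
      note dE = energy_has_derivative[OF this]
      define N' where "N' = inner (G (g t - s)) (f (g t)) / N t"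
      have dN: "(N has_real_derivative N') (at t within {a..b})"
        using DERIV_chain2[OF DERIV_real_sqrt[OF Npos] dE] by (simp add: N_def[abs_def] N'_def field_simps)
      have N': "N' \<le> - (c / sqrt C0) * r"
      proof -
        have Nt: "N t > 0" "N t \<le> sqrt C0 * r"
          using Npos sqrt_energy_upper by (auto simp: N_def r_def)
        have "N' \<le> - c * r\<^sup>2 / N t"
          unfolding N'_def r_def using s(3) Nt(1) by (intro divide_right_mono) auto
        also have "\<dots> \<le> - c * r\<^sup>2 / (sqrt C0 * r)"
          using Nt cL r by (simp add: frac_le)
        also have "\<dots> = - (c / sqrt C0) * r" using r by (simp add: power2_eq_square)
        finally show ?thesis .
      qed
      obtain d2 where d2: "d2 > 0" "\<And>t'. t' \<in> {a..b} \<Longrightarrow> \<bar>t' - t\<bar> < d2 \<Longrightarrow>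
          \<bar>N t' - N t - N' * (t' - t)\<bar> \<le> e' * \<bar>t' - t\<bar>"
        using dN e' unfolding has_field_derivative_def has_derivative_within_alt real_norm_def by blast
      have "u t' \<le> u t + e * (t' - t)" if "t < t'" "t' < t + min d1 d2" "t' \<le> b" for t'
      proof -
        have td: "t' < t + d1" "t' < t + d2" using that(2) by (auto simp: min_def split: if_splits)
        have "N t' \<le> N t + N' * (t' - t) + e' * (t' - t)"
          using d2(2)[of t'] that(1,3) td t by (auto simp: abs_le_iff)
        moreover have "N' * (t' - t) \<le> - (c / sqrt C0) * r * (t' - t)"
          using N' that by (intro mult_right_mono) auto
        moreover have "k * norm (g t' - g t) \<le> k * ((L * r + e') * (t' - t))"
        proof (intro mult_left_mono)
          have "norm (g t' - g t) \<le> (norm (f (g t)) + e') * (t' - t)"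
            using gd[of t'] that(1,3) td t by auto
          also have "\<dots> \<le> (L * r + e') * (t' - t)"
            using s(4) that by (intro mult_right_mono) (auto simp: r_def)
          finally show "norm (g t' - g t) \<le> (L * r + e') * (t' - t)" .
        qed (use k in auto)
        \<comment> \<open>By the choice of \<open>k\<close> the length term cancels the decrease of
          \<open>N\<close> exactly; only multiples of \<open>e'\<close> survive.\<close>
        moreover have "k * L = c / sqrt C0" using cL by (simp add: k_def)
        then have "k * ((L * r + e') * (t' - t)) = c / sqrt C0 * r * (t' - t) + k * (e' * (t' - t))"
          by (simp add: distrib_left distrib_right mult.assoc[symmetric])
        moreover have "energy_dist G K (g t') \<le> N t'" unfolding N_def by (rule energy_dist_le[OF s(1)])
        ultimately have "u t' \<le> N t + k * norm (g t - g a) + (1 + k) * (e' * (t' - t))"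
          using tri[of t'] by (simp add: algebra_simps)
        also have "(1 + k) * (e' * (t' - t)) \<le> (1 + k + sqrt C0) * (e' * (t' - t))"
          using C0 e' that by (intro mult_right_mono) auto
        also have "\<dots> = e * (t' - t)"
          using k C0 by (simp add: e'_def add_pos_nonneg add_nonneg_eq_0_iff)
        finally show ?thesis by (simp add: u_def N_def Dt)
      qed
      moreover have "min d1 d2 > 0" using d1 d2 by simp
      ultimately show ?thesis by blast
    qed
  qed
  then show ?thesis by (simp add: u_def k_def)
qed

section \<open>Existence and continuation of solutions\<close>

text \<open>The fundamental theorem of calculus tolerates one exceptional point and gives the
  integral equation for \<open>y\<close>. Its right-hand side has a continuous integrand, hence is
  differentiable at the exceptional point and at the ends too. This is what makes two glued
  solutions a solution.\<close>

lemma has_vector_derivative_within_except_point: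
  fixes y :: "real \<Rightarrow> 'a::euclidean_space"
  assumes cont: "continuous_on {a..c} y" "continuous_on {a..c} (\<lambda>t. f (y t))"
    and der: "\<And>t. t \<in> {a<..<c} - {b} \<Longrightarrow> (y has_vector_derivative f (y t)) (at t)"
    and t: "t \<in> {a..c}"
  shows "(y has_vector_derivative f (y t)) (at t within {a..c})"
proof -
  have eq: "y t = y a + integral {a..t} (\<lambda>t. f (y t))" if "t \<in> {a..c}" for t
  proof -
    have "((\<lambda>t. f (y t)) has_integral (y t - y a)) {a..t}"
      by (rule fundamental_theorem_of_calculus_interior_strong[where S = "{b}"])
        (use that in \<open>auto intro: der continuous_on_subset[OF cont(1)]\<close>)
    then show ?thesis by (simp add: integral_unique)
  qed
  have *: "((\<lambda>t. y a + integral {a..t} (\<lambda>t. f (y t))) has_vector_derivative f (y t)) (at t within {a..c})"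
    using has_vector_derivative_add[OF has_vector_derivative_const
        integral_has_vector_derivative[OF cont(2) t]] by simp
  show ?thesis by (rule has_vector_derivative_transform[OF t _ *]) (rule eq)
qed

text \<open>Picard iteration: for \<open>L * h < 1\<close> the integral operator is a contraction in
  the supremum norm, and its fixed point solves the equation.\<close>

lemma picard_global:
  fixes g :: "'a::euclidean_space \<Rightarrow> 'a"
  assumes L: "L-lipschitz_on UNIV g" and M: "\<And>x. norm (g x) \<le> M" and h: "h > 0" "L * h < 1"
  shows "\<exists>y. continuous_on {0..h} y \<and> y 0 = x0 \<and>
    (\<forall>t\<in>{0..h}. (y has_vector_derivative g (y t)) (at t within {0..h}))"
proof -
  have cg: "continuous_on X g" for X
    using lipschitz_on_continuous_on[OF L] continuous_on_subset by blast
  \<comment> \<open>Clamping time to \<open>{0..h}\<close> lets the operator act on bounded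
    continuous functions on the whole line, which form a complete space.\<close>
  define c where "c t = max 0 (min h t)" for t :: real
  have c: "c t \<in> {0..h}" "c t \<ge> 0" "c t \<le> h" for t using h by (auto simp: c_def)
  have cc: "continuous_on UNIV c" unfolding c_def by (intro continuous_intros)
  define I where "I y t = x0 + integral {0..c t} (\<lambda>\<tau>. g (apply_bcontfun y \<tau>))" for y t
  have cgy: "continuous_on X (\<lambda>\<tau>. g (apply_bcontfun y \<tau>))" for X and y :: "real \<Rightarrow>\<^sub>C 'a"
    by (rule continuous_on_compose2[OF cg[of UNIV]])
      (auto intro: continuous_on_subset[OF continuous_on_apply_bcontfun])
  have int: "(\<lambda>\<tau>. g (apply_bcontfun y \<tau>)) integrable_on {0..t}" for y :: "real \<Rightarrow>\<^sub>C 'a" and t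
    by (rule integrable_continuous_real[OF cgy])
  have Ibc: "I y \<in> bcontfun" for y
  proof (rule bcontfun_normI)
    have "continuous_on {0..h} (\<lambda>t. integral {0..t} (\<lambda>\<tau>. g (apply_bcontfun y \<tau>)))"
      by (rule indefinite_integral_continuous_1[OF int])
    then have "continuous_on UNIV (\<lambda>t. integral {0..c t} (\<lambda>\<tau>. g (apply_bcontfun y \<tau>)))"
      by (rule continuous_on_compose2[OF _ cc]) (use c in auto)
    then show "continuous_on UNIV (I y)" unfolding I_def by (intro continuous_intros)
    fix t
    have "norm (integral {0..c t} (\<lambda>\<tau>. g (apply_bcontfun y \<tau>))) \<le> M * (c t - 0)"
      by (rule integral_bound[OF _ cgy]) (use c M in auto)
    also have "\<dots> \<le> M * h" using c order_trans[OF norm_ge_zero M[of 0]] by (intro mult_left_mono) auto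
    finally show "norm (I y t) \<le> norm x0 + M * h"
      unfolding I_def by (meson add_left_mono norm_triangle_ineq order_trans)
  qed
  have "\<exists>!y. Bcontfun (I y) = y"
  proof (rule banach_fix_type[of "L * h"], safe)
    show "0 \<le> L * h" using lipschitz_on_nonneg[OF L] h by simp
    show "L * h < 1" by (rule h)
    fix y z :: "real \<Rightarrow>\<^sub>C 'a"
    show "dist (Bcontfun (I y)) (Bcontfun (I z)) \<le> L * h * dist y z"
    proof (rule dist_bound)
      fix t
      have "dist (I y t) (I z t) =
          norm (integral {0..c t} (\<lambda>\<tau>. g (apply_bcontfun y \<tau>) - g (apply_bcontfun z \<tau>)))"
        by (simp add: I_def dist_norm integral_diff int)
      also have "\<dots> \<le> L * dist y z * (c t - 0)"
      proof (rule integral_bound)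
        show "continuous_on {0..c t} (\<lambda>\<tau>. g (apply_bcontfun y \<tau>) - g (apply_bcontfun z \<tau>))"
          by (intro continuous_intros cgy)
        fix \<tau>
        have "norm (g (apply_bcontfun y \<tau>) - g (apply_bcontfun z \<tau>)) \<le> L * dist (apply_bcontfun y \<tau>) (apply_bcontfun z \<tau>)"
          using lipschitz_onD[OF L] by (simp add: dist_norm)
        also have "\<dots> \<le> L * dist y z"
          by (intro mult_left_mono dist_bounded lipschitz_on_nonneg[OF L])
        finally show "norm (g (apply_bcontfun y \<tau>) - g (apply_bcontfun z \<tau>)) \<le> L * dist y z" .
      qed (use c in auto)
      also have "\<dots> \<le> L * dist y z * h"
        using c lipschitz_on_nonneg[OF L] by (intro mult_left_mono) auto
      finally show "dist (apply_bcontfun (Bcontfun (I y)) t) (apply_bcontfun (Bcontfun (I z)) t) \<le> L * h * dist y z"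
        by (simp add: Bcontfun_inverse[OF Ibc] mult_ac)
    qed
  qed
  then obtain y where "Bcontfun (I y) = y" by blast
  then have y: "apply_bcontfun y t = I y t" for t by (metis Bcontfun_inverse[OF Ibc])
  have "(apply_bcontfun y has_vector_derivative g (apply_bcontfun y t)) (at t within {0..h})"
    if t: "t \<in> {0..h}" for t
  proof (rule has_vector_derivative_transform[OF t])
    show "((\<lambda>t. x0 + integral {0..t} (\<lambda>\<tau>. g (apply_bcontfun y \<tau>))) has_vector_derivative
        g (apply_bcontfun y t)) (at t within {0..h})"
      using has_vector_derivative_add[OF has_vector_derivative_const
          integral_has_vector_derivative[OF cgy t]] by simp
    show "apply_bcontfun y t' = x0 + integral {0..t'} (\<lambda>\<tau>. g (apply_bcontfun y \<tau>))" if "t' \<in> {0..h}" for t'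
      using y[of t'] that by (simp add: I_def c_def)
  qed
  moreover have "apply_bcontfun y 0 = x0" using h y[of 0] by (simp add: I_def c_def)
  moreover have "continuous_on {0..h} (apply_bcontfun y)" by simp
  ultimately show ?thesis by blast
qed

lemma norm_diff_le_of_vector_derivative:
  fixes y :: "real \<Rightarrow> 'a::real_normed_vector"
  assumes "convex X" "\<And>t. t \<in> X \<Longrightarrow> (y has_vector_derivative y' t) (at t within X)"
    "\<And>t. t \<in> X \<Longrightarrow> norm (y' t) \<le> M" "a \<in> X" "b \<in> X"
  shows "norm (y b - y a) \<le> M * \<bar>b - a\<bar>"
proof -
  have "norm (y b - y a) \<le> M * norm (b - a)"
  proof (rule differentiable_bound[OF assms(1)])
    fix t assume "t \<in> X"
    then show "(y has_derivative (\<lambda>h. h *\<^sub>R y' t)) (at t within X)"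
      using assms(2) by (simp add: has_vector_derivative_def)
    have "norm (h *\<^sub>R y' t) \<le> M * norm h" for h
      using mult_right_mono[OF assms(3)[OF \<open>t \<in> X\<close>] abs_ge_zero[of h]] by (simp add: mult.commute)
    then show "onorm (\<lambda>h. h *\<^sub>R y' t) \<le> M" by (rule onorm_le)
  qed (use assms in auto)
  then show ?thesis by simp
qed

text \<open>Composing \<open>f\<close> with the nearest-point projection onto the ball, which does
  not increase distances, gives a bounded and globally Lipschitz field. Its solution stays in the
  ball for a short time, and there the projection is the identity.\<close>

lemma picard_local:
  fixes f :: "'a::euclidean_space \<Rightarrow> 'a"
  assumes L: "L-lipschitz_on (cball x0 r) f" and r: "r > 0"
  shows "\<exists>h>0. \<exists>y. continuous_on {0..h} y \<and> y 0 = x0 \<and>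
    (\<forall>t\<in>{0..h}. (y has_vector_derivative f (y t)) (at t within {0..h}))"
proof -
  have ne: "cball x0 r \<noteq> {}" using r by simp
  define p where "p = closest_point (cball x0 r)"
  have p: "p x \<in> cball x0 r" for x
    unfolding p_def by (rule closest_point_in_set) (use ne in auto)
  have p_id: "p x = x" if "x \<in> cball x0 r" for x
    unfolding p_def using that by (rule closest_point_self)
  have L0: "L \<ge> 0" by (rule lipschitz_on_nonneg[OF L])
  have lip: "L-lipschitz_on UNIV (\<lambda>x. f (p x))"
  proof (rule lipschitz_onI)
    fix x y
    have "dist (f (p x)) (f (p y)) \<le> L * dist (p x) (p y)" by (rule lipschitz_onD[OF L p p])
    also have "\<dots> \<le> L * dist x y"
      unfolding p_def by (intro mult_left_mono closest_point_lipschitz L0) (use ne in auto)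
    finally show "dist (f (p x)) (f (p y)) \<le> L * dist x y" .
  qed (rule L0)
  define M where "M = norm (f x0) + L * r"
  have M: "norm (f (p x)) \<le> M" for x
  proof -
    have "norm (f (p x) - f x0) \<le> L * dist (p x) x0"
      using lipschitz_onD[OF L p, of x0] r by (simp add: dist_norm)
    also have "\<dots> \<le> L * r" using p[of x] L0 by (intro mult_left_mono) (auto simp: dist_commute)
    finally show ?thesis unfolding M_def using norm_triangle_sub[of "f (p x)" "f x0"] by simp
  qed
  have M0: "M \<ge> 0" using M norm_ge_zero order_trans by blast
  \<comment> \<open>The first bound keeps the solution inside the ball, the second makes the
    iteration contract. Adding 1 keeps the denominators positive and \<open>L * h < 1\<close>
    strict.\<close>
  define h where "h = min (r / (M + 1)) (1 / (L + 1))"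
  have h: "h > 0" using r M0 L0 by (simp add: h_def)
  have "M * h \<le> (M + 1) * (r / (M + 1))" "L * h \<le> L * (1 / (L + 1))"
    using M0 L0 h by (intro mult_mono mult_left_mono; simp add: h_def)+
  then have Mh: "M * h \<le> r" and Lh: "L * h < 1" using M0 L0
    by (auto simp: divide_less_eq elim: order.strict_trans1)
  obtain y where y: "continuous_on {0..h} y" "y 0 = x0"
      "\<And>t. t \<in> {0..h} \<Longrightarrow> (y has_vector_derivative f (p (y t))) (at t within {0..h})"
    using picard_global[OF lip M h Lh] by blast
  have "y t \<in> cball x0 r" if t: "t \<in> {0..h}" for t
  proof -
    have "norm (y t - y 0) \<le> M * \<bar>t - 0\<bar>"
      by (rule norm_diff_le_of_vector_derivative[OF _ y(3)]) (use M t h in auto)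
    also have "\<dots> \<le> M * h" using t M0 by (intro mult_left_mono) auto
    finally show ?thesis using Mh y(2) by (simp add: dist_norm norm_minus_commute)
  qed
  then show ?thesis using h y p_id by metis
qed

text \<open>The speed is bounded on the compact ball of radius \<open>R\<close>, so the solution is
  Lipschitz in time and has a limit at time \<open>b\<close>. From this limit a local solution
  starts, and the two are glued.\<close>

lemma finite_time_solution_extends:
  fixes f :: "'a::euclidean_space \<Rightarrow> 'a"
  assumes L: "L-lipschitz_on (cball s r) f" and R: "R < r" and cf: "continuous_on UNIV f"
    and sol: "solution_on f (ereal b) y" and yR: "\<And>t. 0 \<le> t \<Longrightarrow> t < b \<Longrightarrow> y t \<in> cball s R"
  shows "\<exists>T' y'. ereal b < T' \<and> solution_on f T' y' \<and> (\<forall>t. 0 \<le> t \<and> ereal t < ereal b \<longrightarrow> y' t = y t)"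
proof -
  have b: "b > 0" using sol by (simp add: solution_on_def)
  have X: "{t. 0 \<le> t \<and> ereal t < ereal b} = {0..<b}" by auto
  have dy: "(y has_vector_derivative f (y t)) (at t within {0..<b})" if "t \<in> {0..<b}" for t
    using sol that unfolding solution_on_def X by auto
  obtain M where M: "\<And>x. x \<in> cball s R \<Longrightarrow> norm (f x) \<le> M"
    using compact_imp_bounded[OF compact_continuous_image[OF continuous_on_subset[OF cf] compact_cball]]
    unfolding bounded_iff by (metis imageI subset_UNIV)
  have "norm (y 0) \<ge> 0" "y 0 \<in> cball s R" using yR b by auto
  then have M0: "M \<ge> 0" using M norm_ge_zero order_trans by blast
  have "M-lipschitz_on {0..<b} y"
    by (intro lipschitz_onI M0) (auto simp: dist_norm intro!: norm_diff_le_of_vector_derivative[OF _ dy] M yR)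
  then have "uniformly_continuous_on {0..<b} y" by (rule lipschitz_on_uniformly_continuous)
  then obtain g where g: "uniformly_continuous_on (closure {0..<b}) g" "\<And>t. t \<in> {0..<b} \<Longrightarrow> y t = g t"
    by (rule uniformly_continuous_on_extension_on_closure) blast
  have cg: "continuous_on {0..b} g"
    using uniformly_continuous_imp_continuous[OF g(1)] b by simp
  have "g b \<in> cball s R"
  proof -
    have "g ` closure {0..<b} \<subseteq> cball s R"
      by (rule image_closure_subset) (use cg b g(2) yR in auto)
    then show ?thesis using b by (auto simp: image_subset_iff)
  qed
  \<comment> \<open>The margin between \<open>R\<close> and \<open>r\<close> is the room in which
    the field is known to be Lipschitz around the end point.\<close>
  then have "cball (g b) (r - R) \<subseteq> cball s r"
    by (auto simp: cball_subset_cball_iff dist_commute)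
  from picard_local[OF lipschitz_on_subset[OF L this]] R
  obtain h z where h: "h > 0" and z: "continuous_on {0..h} z" "z 0 = g b"
      "\<And>t. t \<in> {0..h} \<Longrightarrow> (z has_vector_derivative f (z t)) (at t within {0..h})"
    by auto
  define w where "w t = (if t \<le> b then g t else z (t - b))" for t
  have cw: "continuous_on {0..b + h} w"
  proof -
    have "continuous_on ({0..b} \<union> {b..b + h}) w"
      unfolding w_def
    proof (rule continuous_on_cases)
      show "continuous_on {b..b + h} (\<lambda>t. z (t - b))"
        by (rule continuous_on_compose2[OF z(1)]) (auto intro!: continuous_intros)
    qed (use cg z(2) in auto)
    moreover have "{0..b} \<union> {b..b + h} = {0..b + h}" using b h by auto
    ultimately show ?thesis by simp
  qed
  have dw: "(w has_vector_derivative f (w t)) (at t within {0..b + h})" if "t \<in> {0..b + h}" for t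
  \<comment> \<open>At the gluing time only continuity of \<open>w\<close> is known
    directly.\<close>
  proof (rule has_vector_derivative_within_except_point[OF cw _ _ that, where b = b])
    show "continuous_on {0..b + h} (\<lambda>t. f (w t))"
      by (rule continuous_on_compose2[OF cf cw]) auto
    fix t assume t: "t \<in> {0<..<b + h} - {b}"
    show "(w has_vector_derivative f (w t)) (at t)"
    proof (cases "t < b")
      case True
      have "(y has_vector_derivative f (y t)) (at t within {0<..<b})"
        by (rule has_vector_derivative_within_subset[OF dy]) (use t True in auto)
      then have "(y has_vector_derivative f (w t)) (at t)"
        using t True g(2) by (simp add: at_within_open[of _ "{0<..<b}"] w_def)
      then show ?thesis
        by (rule has_vector_derivative_transform_within_open[of _ _ _ "{0<..<b}"])
          (use t True g(2) in \<open>auto simp: w_def\<close>)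
    next
      case False
      have "(z has_vector_derivative f (z (t - b))) (at (t - b) within {0<..<h})"
        by (rule has_vector_derivative_within_subset[OF z(3)]) (use t False in auto)
      then have *: "(z has_vector_derivative f (z (t - b))) (at (t - b))"
        using t False by (subst (asm) at_within_open) auto
      have "((\<lambda>t. t - b) has_vector_derivative 1) (at t)"
        by (auto intro!: derivative_eq_intros)
      from vector_diff_chain_at[OF this *]
      have "((\<lambda>t. z (t - b)) has_vector_derivative f (w t)) (at t)"
        using t False by (simp add: o_def w_def)
      then show ?thesis
        by (rule has_vector_derivative_transform_within_open[of _ _ _ "{b<..<b + h}"])
          (use t False in \<open>auto simp: w_def\<close>)
    qed
  qed
  have "solution_on f (ereal (b + h)) w"
    unfolding solution_on_def using b h
    by (auto intro!: has_vector_derivative_within_subset[OF dw])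
  moreover have "\<forall>t. 0 \<le> t \<and> ereal t < ereal b \<longrightarrow> w t = y t"
    by (auto simp: w_def g(2))
  moreover have "ereal b < ereal (b + h)" using h by simp
  ultimately show ?thesis by blast
qed

text \<open>Over \<open>[n, n + 1]\<close> the increments of \<open>y\<close> tend to 0. Tested
  against the vector \<open>f x\<close>, which makes the mean value theorem for real functions
  applicable, they also tend to \<open>inner (f x) (f x)\<close>.\<close>

lemma equilibrium_of_convergent_solution:
  fixes f :: "'a::euclidean_space \<Rightarrow> 'a"
  assumes cf: "continuous_on UNIV f" and sol: "solution_on f \<infinity> y" and lim: "(y \<longlongrightarrow> x) at_top"
  shows "f x = 0"
proof -
  have dy: "(y has_vector_derivative f (y t)) (at t within {0..})" if "t \<ge> 0" for t
    using sol that unfolding solution_on_def atLeast_def by auto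
  have flim: "((\<lambda>t. f (y t)) \<longlongrightarrow> f x) at_top"
    by (rule continuous_on_tendsto_compose[OF cf lim]) auto
  have "\<exists>\<xi>>real n. inner (f x) (y (real n + 1) - y (real n)) = inner (f x) (f (y \<xi>))" for n
  proof -
    have "\<exists>\<xi>\<in>{real n<..<real n + 1}. inner (f x) (y (real n + 1)) - inner (f x) (y (real n)) =
        (\<lambda>d. d * inner (f x) (f (y \<xi>))) (real n + 1 - real n)"
    proof (rule mvt_simple)
      fix t assume t: "real n \<le> t" "t \<le> real n + 1"
      have "((\<lambda>t. inner (f x) (y t)) has_vector_derivative inner (f x) (f (y t))) (at t within {real n..real n + 1})"
        by (rule bounded_linear.has_vector_derivative[OF bounded_linear_inner_right])
          (rule has_vector_derivative_within_subset[OF dy], use t in auto)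
      then show "((\<lambda>t. inner (f x) (y t)) has_derivative (\<lambda>d. d * inner (f x) (f (y t)))) (at t within {real n..real n + 1})"
        by (simp add: has_vector_derivative_def)
    qed simp
    then show ?thesis by (auto simp: inner_diff_right)
  qed
  then obtain \<xi> where \<xi>: "\<And>n. \<xi> n > real n"
    "\<And>n. inner (f x) (y (real n + 1) - y (real n)) = inner (f x) (f (y (\<xi> n)))" by metis
  have "filterlim \<xi> at_top sequentially"
    by (rule filterlim_at_top_mono[OF filterlim_real_sequentially]) (use \<xi>(1) less_imp_le in \<open>auto intro!: always_eventually\<close>)
  from filterlim_compose[OF flim this]
  have 1: "(\<lambda>n. inner (f x) (f (y (\<xi> n)))) \<longlonglongrightarrow> inner (f x) (f x)"
    by (intro tendsto_intros)
  have "(\<lambda>n. y (real n + 1) - y (real n)) \<longlonglongrightarrow> x - x"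
  proof (intro tendsto_diff filterlim_compose[OF lim] filterlim_real_sequentially)
    show "filterlim (\<lambda>n. real n + 1) at_top sequentially"
      by (rule filterlim_at_top_mono[OF filterlim_real_sequentially]) (auto intro!: always_eventually)
  qed
  then have "(\<lambda>n. inner (f x) (y (real n + 1) - y (real n))) \<longlonglongrightarrow> inner (f x) (x - x)"
    by (rule tendsto_inner[OF tendsto_const])
  then have 2: "(\<lambda>n. inner (f x) (f (y (\<xi> n)))) \<longlonglongrightarrow> 0" by (simp add: \<xi>(2))
  from LIMSEQ_unique[OF 1 2] show ?thesis by simp
qed

section \<open>Convergence of trajectories\<close>

text \<open>The distance to \<open>K\<close> at the start bounds the displacement from then on, as
  long as the trajectory stays in the ball. A start close to \<open>s\<close> therefore cannot reach
  the sphere of radius \<open>R\<close>; confinement excludes a finite life time, and the vanishing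
  of the remaining decrease makes the trajectory Cauchy.\<close>

lemma (in energy_form) trajectory_converges:
  assumes K: "compact K" "s \<in> K" and cL: "c > 0" "L > 0" and r: "r > 0" and \<epsilon>: "\<epsilon> > 0"
    and cf: "continuous_on UNIV f" and lip: "M-lipschitz_on (ball s r) f"
    and step: "\<And>x. x \<in> ball s r \<Longrightarrow> \<exists>s\<in>K. (\<forall>s'\<in>K. energy G (x - s) \<le> energy G (x - s')) \<and>
        inner (G (x - s)) (f x) \<le> - c * (norm (x - s))\<^sup>2 \<and> norm (f x) \<le> L * norm (x - s)"
  shows "\<exists>\<delta>>0. \<forall>T y. trajectory f T y \<and> y 0 \<in> ball s \<delta> \<longrightarrow>
    T = \<infinity> \<and> (\<forall>t\<ge>0. dist (y t) s < \<epsilon>) \<and> (\<exists>x\<in>K. (y \<longlongrightarrow> x) at_top)"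
proof -
  \<comment> \<open>Strictly below both radii: below \<open>\<epsilon>\<close> for the claim, below
    \<open>r\<close> to leave room for continuation.\<close>
  define R where "R = min \<epsilon> r / 2"
  have R: "R > 0" "R < \<epsilon>" "R < r" using \<epsilon> r by (auto simp: R_def)
  define k where "k = c / (L * sqrt C0)"
  have k: "k > 0" using cL C0 by (simp add: k_def)
  \<comment> \<open>The initial offset \<open>norm (y 0 - s)\<close> plus the available displacement
    \<open>energy_dist G K (y 0) / k\<close> is at most \<open>(1 + sqrt C0 / k)\<close> times the
    offset, hence below \<open>R\<close>.\<close>
  define \<delta> where "\<delta> = R / (1 + sqrt C0 / k)"
  have q: "1 + sqrt C0 / k > 0" using k C0 by (simp add: add_pos_nonneg)
  have \<delta>: "\<delta> > 0" using R q by (simp add: \<delta>_def)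
  have ne: "K \<noteq> {}" using K by auto
  have "T = \<infinity> \<and> (\<forall>t\<ge>0. dist (y t) s < \<epsilon>) \<and> (\<exists>x\<in>K. (y \<longlongrightarrow> x) at_top)"
    if tr: "trajectory f T y" and y0: "y 0 \<in> ball s \<delta>" for T y
  proof -
    have sol: "solution_on f T y" and T: "T > 0" using tr by (auto simp: trajectory_def solution_on_def)
    have dy: "(y has_vector_derivative f (y t)) (at t within {a..b})"
      if "0 \<le> a" "ereal b < T" "t \<in> {a..b}" for t a b
    proof -
      have "ereal t' < T" if "t' \<le> b" for t'
        using that \<open>ereal b < T\<close> by (meson ereal_less_eq(3) order.strict_trans1)
      then have sub: "{a..b} \<subseteq> {s. 0 \<le> s \<and> ereal s < T}" using that by auto
      then have "(y has_vector_derivative f (y t)) (at t within {s. 0 \<le> s \<and> ereal s < T})"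
        using sol that(3) unfolding solution_on_def by blast
      then show ?thesis by (rule has_vector_derivative_within_subset[OF _ sub])
    qed
    have cy: "continuous_on {a..b} y" if "0 \<le> a" "ereal b < T" for a b
      using dy[OF that] by (meson continuous_on_eq_continuous_within has_vector_derivative_continuous)
    have dec: "energy_dist G K (y b) + k * norm (y b - y a) \<le> energy_dist G K (y a)"
      if "0 \<le> a" "a \<le> b" "ereal b < T" "\<And>t. t \<in> {a..b} \<Longrightarrow> y t \<in> ball s r" for a b
      unfolding k_def
      by (rule energy_dist_decrease[OF K(1) ne bounded_ball cL step that(2) dy that(4)]) (use that in auto)
    have start: "norm (y 0 - s) + energy_dist G K (y 0) / k < R"
    proof -
      have "energy_dist G K (y 0) \<le> sqrt C0 * norm (y 0 - s)"
        using energy_dist_le[OF K(2)] sqrt_energy_upper order_trans by blast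
      then have "norm (y 0 - s) + energy_dist G K (y 0) / k \<le> norm (y 0 - s) * (1 + sqrt C0 / k)"
        using k by (simp add: field_simps)
      also have "\<dots> < \<delta> * (1 + sqrt C0 / k)"
        using y0 q by (intro mult_strict_right_mono) (auto simp: dist_norm norm_minus_commute)
      also have "\<dots> = R" using q by (simp add: \<delta>_def)
      finally show ?thesis .
    qed
    have y0R: "dist s (y 0) < R"
      using start energy_dist_nonneg[OF ne, of "y 0"] k
      by (smt (verit) dist_norm divide_nonneg_pos norm_minus_commute)
    have inR: "y t \<in> ball s R" if t: "0 \<le> t" "ereal t < T" for t
    proof (rule ccontr)
      assume "y t \<notin> ball s R"
      then have tR: "dist s (y t) \<ge> R" by simp
      \<comment> \<open>The least element of \<open>A\<close> is the first time on the sphere. Until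
        then the trajectory lies in the ball where the decrease is known, so the displacement bound
        contradicts the arrival.\<close>
      define A where "A = {\<tau> \<in> {0..t}. dist s (y \<tau>) = R}"
      have cd: "continuous_on {0..t} (\<lambda>\<tau>. dist s (y \<tau>))"
        by (intro continuous_intros cy) (use t in auto)
      have ex: "\<exists>\<tau>\<in>A. \<tau> \<le> t'" if "t' \<in> {0..t}" "dist s (y t') \<ge> R" for t'
      proof -
        have "\<exists>\<tau>\<ge>0. \<tau> \<le> t' \<and> dist s (y \<tau>) = R"
          by (rule IVT') (use that y0R in \<open>auto intro: continuous_on_subset[OF cd]\<close>)
        then show ?thesis using that by (auto simp: A_def)
      qed
      have cA: "closed A" unfolding A_def
        using continuous_closed_preimage_constant[OF cd closed_atLeastAtMost] by simp
      have bd: "bdd_below A" by (auto simp: A_def intro: bdd_belowI[of _ 0])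
      have "A \<noteq> {}" using ex[of t] tR t by auto
      then have mA: "Inf A \<in> A" by (intro closed_contains_Inf bd cA)
      define m where "m = Inf A"
      have m: "0 \<le> m" "m \<le> t" "dist s (y m) = R" using mA by (auto simp: A_def m_def)
      have "ereal m < T" using m t by (meson ereal_less_eq(3) order.strict_trans1)
      moreover have "y \<tau> \<in> ball s r" if \<tau>: "\<tau> \<in> {0..m}" for \<tau>
      proof (cases "dist s (y \<tau>) \<ge> R")
        case True
        with ex[of \<tau>] \<tau> m obtain \<sigma> where "\<sigma> \<in> A" "\<sigma> \<le> \<tau>" by auto
        then have "m \<le> \<tau>" unfolding m_def using bd by (meson cInf_lower order_trans)
        then show ?thesis using \<tau> m R by auto
      qed (use R in auto)
      ultimately have "k * norm (y m - y 0) \<le> energy_dist G K (y 0)"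
        using dec[of 0 m] m energy_dist_nonneg[OF ne, of "y m"] by auto
      then have "norm (y m - y 0) \<le> energy_dist G K (y 0) / k"
        using k by (simp add: field_simps)
      moreover have "dist s (y m) \<le> norm (y 0 - s) + norm (y m - y 0)"
        using dist_triangle[of s "y m" "y 0"] by (simp add: dist_norm norm_minus_commute)
      ultimately show False using start m by simp
    qed
    have Tinf: "T = \<infinity>"
    proof (cases T)
      case (real b)
      \<comment> \<open>An intermediate closed ball, since the Lipschitz bound is given on the open
        ball of radius \<open>r\<close>.\<close>
      have "cball s ((R + r) / 2) \<subseteq> ball s r" using R by (auto simp: field_simps)
      then have L': "M-lipschitz_on (cball s ((R + r) / 2)) f" by (rule lipschitz_on_subset[OF lip])
      have "\<exists>T' y'. ereal b < T' \<and> solution_on f T' y' \<and> (\<forall>t. 0 \<le> t \<and> ereal t < ereal b \<longrightarrow> y' t = y t)"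
        by (rule finite_time_solution_extends[OF L' _ cf]) (use sol real R inR less_imp_le in auto)
      then show ?thesis using tr real unfolding trajectory_def by blast
    qed (use T in auto)
    have inR': "y t \<in> ball s R" if "t \<ge> 0" for t using inR[of t] that Tinf by simp
    have dec': "k * norm (y b - y a) \<le> energy_dist G K (y a) - energy_dist G K (y b)"
      if "0 \<le> a" "a \<le> b" for a b
    proof -
      have "y t \<in> ball s r" if "t \<ge> 0" for t using inR'[OF that] R by auto
      then show ?thesis using dec[OF that(1,2)] that Tinf by auto
    qed
    \<comment> \<open>Once the distance is within \<open>k * e\<close> of its infimum, any later
      displacement is below \<open>e\<close>.\<close>
    define l where "l = (INF t\<in>{0..}. energy_dist G K (y t))"
    have bd: "bdd_below ((\<lambda>t. energy_dist G K (y t)) ` {0..})"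
      by (intro bdd_belowI2[of _ 0] energy_dist_nonneg ne)
    have cauchy: "\<exists>t0\<ge>0. \<forall>t\<ge>t0. norm (y t - y t0) < e" if e: "e > 0" for e
    proof -
      have "\<exists>t0\<in>{0..}. energy_dist G K (y t0) < l + k * e"
        unfolding l_def using e k by (subst cINF_less_iff[OF _ bd, symmetric]) auto
      then obtain t0 where t0: "t0 \<ge> 0" "energy_dist G K (y t0) < l + k * e" by auto
      have "norm (y t - y t0) < e" if "t \<ge> t0" for t
      proof -
        have "l \<le> energy_dist G K (y t)" unfolding l_def using that t0 by (intro cINF_lower bd) auto
        then have "k * norm (y t - y t0) < k * e" using dec'[of t0 t] that t0 by auto
        then show ?thesis using k by simp
      qed
      then show ?thesis using t0 by blast
    qed
    have "Cauchy (\<lambda>n. y (real n))"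
    proof (rule metric_CauchyI)
      fix e :: real assume "e > 0"
      then obtain t0 where t0: "\<And>t. t \<ge> t0 \<Longrightarrow> norm (y t - y t0) < e / 2" using cauchy[of "e / 2"] by auto
      have "dist (y (real m)) (y (real n)) < e" if "m \<ge> nat \<lceil>t0\<rceil>" "n \<ge> nat \<lceil>t0\<rceil>" for m n
        by (rule dist_triangle_half_l[of _ "y t0"]) (use t0[of m] t0[of n] that in \<open>auto simp: dist_norm norm_minus_commute\<close>)
      then show "\<exists>N. \<forall>m\<ge>N. \<forall>n\<ge>N. dist (y (real m)) (y (real n)) < e" by blast
    qed
    then obtain x where x: "(\<lambda>n. y (real n)) \<longlonglongrightarrow> x"
      using convergent_eq_Cauchy unfolding convergent_def by blast
    have lim: "(y \<longlongrightarrow> x) at_top"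
    proof (rule tendstoI)
      fix e :: real assume e: "e > 0"
      then obtain t0 where t0: "\<And>t. t \<ge> t0 \<Longrightarrow> norm (y t - y t0) < e / 3" using cauchy[of "e / 3"] by auto
      have "dist (y t0) x \<le> e / 3"
      proof (rule tendsto_upperbound)
        show "(\<lambda>n. dist (y t0) (y (real n))) \<longlonglongrightarrow> dist (y t0) x" by (intro tendsto_intros x)
        have "eventually (\<lambda>n. n \<ge> nat \<lceil>t0\<rceil>) sequentially" by (rule eventually_ge_at_top)
        then show "\<forall>\<^sub>F n in sequentially. dist (y t0) (y (real n)) \<le> e / 3"
        proof eventually_elim
          case (elim n)
          then have "real n \<ge> t0" by linarith
          from t0[OF this] show ?case by (simp add: dist_norm norm_minus_commute)
        qed
      qed simp
      then have "dist (y t) x < e" if "t \<ge> t0" for t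
        using t0[OF that] dist_triangle[of "y t" x "y t0"] e by (simp add: dist_norm)
      then show "\<forall>\<^sub>F t in at_top. dist (y t) x < e" by (auto simp: eventually_at_top_linorder)
    qed
    have "f x = 0" by (rule equilibrium_of_convergent_solution[OF cf _ lim]) (use sol Tinf in simp)
    moreover have "x \<in> cball s R"
      by (rule Lim_in_closed_set[OF closed_cball _ _ x]) (use inR' in \<open>auto intro!: always_eventually less_imp_le\<close>)
    then have "x \<in> ball s r" using R by auto
    ultimately obtain s' where s': "s' \<in> K" "c * (norm (x - s'))\<^sup>2 \<le> 0" using step[of x] by auto
    then have "x = s'" using cL by (simp add: mult_le_0_iff)
    then show ?thesis using Tinf inR' R lim s' by (force simp: dist_commute)
  qed
  then show ?thesis using \<delta> by blast
qed

section \<open>Piecewise smooth vector fields\<close>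

text \<open>Finitely many closed sets cover the interval, so every point close to \<open>t\<close>
  lies in some \<open>C i\<close> that also contains \<open>t\<close>. On these two points
  \<open>u\<close> agrees with the single smooth function \<open>v i\<close>, to which the ordinary
  mean value theorem applies.\<close>

lemma piecewise_mean_value:
  fixes u :: "real \<Rightarrow> real"
  assumes cont: "continuous_on {0..1} u" and fin: "finite I" and cl: "\<And>i. i \<in> I \<Longrightarrow> closed (C i)"
    and cov: "{0..1} \<subseteq> (\<Union>i\<in>I. C i)"
    and eq: "\<And>i t. i \<in> I \<Longrightarrow> t \<in> {0..1} \<inter> C i \<Longrightarrow> u t = v i t"
    and der: "\<And>i t. i \<in> I \<Longrightarrow> t \<in> {0..1} \<Longrightarrow> (v i has_real_derivative v' i t) (at t within {0..1})"
    and bound: "\<And>i t. i \<in> I \<Longrightarrow> t \<in> {0..1} \<Longrightarrow> v' i t \<le> K"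
  shows "u 1 \<le> u 0 + K"
proof -
  have "u 1 \<le> u 0 + K * (1 - 0)"
  proof (rule right_local_growth_bound[OF _ cont])
    fix t :: real assume t: "0 \<le> t" "t < 1"
    have "closed (\<Union>i\<in>{i \<in> I. t \<notin> C i}. C i)" using fin cl by (intro closed_UN) auto
    then have "open (- (\<Union>i\<in>{i \<in> I. t \<notin> C i}. C i))" by (rule open_Compl)
    then obtain d where d: "d > 0" "ball t d \<subseteq> - (\<Union>i\<in>{i \<in> I. t \<notin> C i}. C i)"
      by (rule openE[of _ t]) auto
    have "u t' \<le> u t + K * (t' - t)" if t': "t < t'" "t' < t + d" "t' \<le> 1" for t'
    proof -
      obtain i where i: "i \<in> I" "t' \<in> C i" using subsetD[OF cov, of t'] t t' by auto
      moreover have "t' \<in> ball t d" using t' by (auto simp: dist_real_def)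
      ultimately have ti: "t \<in> C i" using d(2) by blast
      \<comment> \<open>Between \<open>t\<close> and \<open>t'\<close> the function \<open>u\<close>
        may leave this piece; \<open>v i\<close> is still differentiable there with the same slope
        bound.\<close>
      have "\<exists>\<xi>\<in>{t<..<t'}. v i t' - v i t = (\<lambda>h. v' i \<xi> * h) (t' - t)"
      proof (rule mvt_simple[OF t'(1)])
        fix x assume x: "t \<le> x" "x \<le> t'"
        have "(v i has_real_derivative v' i x) (at x within {t..t'})"
          by (rule has_field_derivative_subset[OF der[OF i(1)]]) (use x t t' in auto)
        then show "(v i has_derivative (\<lambda>h. v' i x * h)) (at x within {t..t'})"
          by (simp add: has_field_derivative_def)
      qed
      then obtain \<xi> where \<xi>: "\<xi> \<in> {t<..<t'}" "v i t' - v i t = v' i \<xi> * (t' - t)" by auto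
      have le: "v' i \<xi> * (t' - t) \<le> K * (t' - t)"
        using bound[OF i(1), of \<xi>] \<xi> t t' by (intro mult_right_mono) auto
      have "u t = v i t" "u t' = v i t'" using eq[OF i(1)] ti i(2) t t' by auto
      then show ?thesis using \<xi>(2) le by linarith
    qed
    with d(1) show "\<exists>d>0. \<forall>t'. t < t' \<and> t' < t + d \<and> t' \<le> 1 \<longrightarrow> u t' \<le> u t + K * (t' - t)" by blast
  qed simp
  then show ?thesis by simp
qed

text \<open>Approach \<open>s\<close> through the open patch: there \<open>f\<close> agrees with
  \<open>g\<close> on a neighbourhood of each point, so it is differentiable with derivative
  \<open>g'\<close>, and continuity of \<open>g'\<close> identifies the limit.\<close>

lemma Jacobian_limit_of_patch:
  fixes f g :: "'a::euclidean_space \<Rightarrow> 'a" and g' :: "'a \<Rightarrow> 'a \<Rightarrow>\<^sub>L 'a"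
  assumes D: "open D" "s \<in> closure D" "closure D \<subseteq> U" and fg: "\<And>y. y \<in> closure D \<Longrightarrow> f y = g y"
    and der: "\<And>x. x \<in> U \<Longrightarrow> (g has_derivative blinfun_apply (g' x)) (at x)" and cg': "continuous_on U g'"
  shows "Matrix.mat DIM('a) DIM('a)
      (\<lambda>(i, j). inner (from_nat_into Basis i) (blinfun_apply (g' s) (from_nat_into Basis j)))
    \<in> Jacobian_limits f s"
proof -
  obtain ys where ys: "\<And>k. ys k \<in> D" "ys \<longlonglongrightarrow> s" using D(2) unfolding closure_sequential by blast
  have dU: "x \<in> U" if "x \<in> D" for x using that D(3) closure_subset by blast
  have df: "(f has_derivative blinfun_apply (g' x)) (at x)" if x: "x \<in> D" for x
    by (rule has_derivative_transform_within_open[OF der[OF dU[OF x]] D(1) x])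
      (use fg closure_subset[of D] in auto)
  have fd: "frechet_derivative f (at x) = blinfun_apply (g' x)" if "x \<in> D" for x
    using frechet_derivative_at[OF df[OF that]] by simp
  have "(\<lambda>k. g' (ys k)) \<longlonglongrightarrow> g' s"
    by (rule continuous_on_tendsto_compose[OF cg' ys(2)]) (use D ys dU in auto)
  then have "(\<lambda>k. inner (from_nat_into Basis i) (blinfun_apply (g' (ys k)) (from_nat_into Basis j)))
      \<longlonglongrightarrow> inner (from_nat_into Basis i) (blinfun_apply (g' s) (from_nat_into Basis j))" for i j
    by (intro tendsto_intros)
  moreover have "f differentiable (at (ys k))" for k
    using df[OF ys(1)] unfolding differentiable_def by blast
  ultimately show ?thesis
    unfolding Jacobian_limits_def Jacobian_def nondiff_points_def
    using ys by (auto simp: fd intro!: exI[of _ ys])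
qed

text \<open>The patch index depends on \<open>l\<close>. Only scalar inequalities are needed later, so no matrix in the convex
  hull of the patch derivatives has to be produced.\<close>

lemma piecewise_C2_increment_bound:
  fixes f :: "'a::euclidean_space \<Rightarrow> 'a"
  assumes "piecewise_C2 f"
  obtains I :: "nat set" and \<Lambda> :: "nat \<Rightarrow> 'a \<Rightarrow>\<^sub>L 'a"
  where "finite I"
    "\<And>i. i \<in> I \<Longrightarrow> Matrix.mat DIM('a) DIM('a)
      (\<lambda>(j, k). inner (from_nat_into Basis j) (blinfun_apply (\<Lambda> i) (from_nat_into Basis k))) \<in> Jacobian_limits f s"
    "\<And>\<epsilon>. \<epsilon> > 0 \<Longrightarrow> \<exists>\<delta>>0. \<forall>x\<in>ball s \<delta>. \<forall>y\<in>ball s \<delta>. \<forall>l. \<exists>i\<in>I.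
      inner l (f x - f y) \<le> inner l (blinfun_apply (\<Lambda> i) (x - y)) + \<epsilon> * norm l * norm (x - y)"
proof -
  have cf: "continuous_on UNIV f" using assms by (simp add: piecewise_C2_def)
  obtain r :: nat and D De :: "nat \<Rightarrow> 'a set" and g where
    D: "\<And>i. i < r \<Longrightarrow> open (D i)" and cov: "(\<Union>i<r. closure (D i)) = UNIV" and
    De: "\<And>i. i < r \<Longrightarrow> open (De i)" "\<And>i. i < r \<Longrightarrow> closure (D i) \<subseteq> De i"
      "\<And>i. i < r \<Longrightarrow> C2_on (g i) (De i)" and
    fg: "\<And>i y. i < r \<Longrightarrow> y \<in> closure (D i) \<Longrightarrow> f y = g i y"
    using assms unfolding piecewise_C2_def by blast
  have "\<exists>g'. \<forall>i<r. (\<forall>x\<in>De i. (g i has_derivative blinfun_apply (g' i x)) (at x)) \<and> C1_on (g' i) (De i)"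
    using De(3) unfolding C2_on_def by metis
  then obtain g' :: "nat \<Rightarrow> 'a \<Rightarrow> 'a \<Rightarrow>\<^sub>L 'a" where
    g': "\<And>i x. i < r \<Longrightarrow> x \<in> De i \<Longrightarrow> (g i has_derivative blinfun_apply (g' i x)) (at x)"
    and C1: "\<And>i. i < r \<Longrightarrow> C1_on (g' i) (De i)" by blast
  have cg': "continuous_on (De i) (g' i)" if "i < r" for i
    using C1[OF that] unfolding C1_on_def
    by (meson continuous_at_imp_continuous_on has_derivative_continuous)
  \<comment> \<open>The patches active at \<open>s\<close>; exactly these yield limiting Jacobians
    through \<open>Jacobian_limit_of_patch\<close>.\<close>
  define I where "I = {i. i < r \<and> s \<in> closure (D i)}"
  have fin: "finite I" by (simp add: I_def)
  have ne: "I \<noteq> {}" using cov by (auto simp: I_def)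
  show ?thesis
  proof (rule that[of I "\<lambda>i. g' i s"])
    show "finite I" by (rule fin)
  next
    fix i assume "i \<in> I"
    then show "Matrix.mat DIM('a) DIM('a)
      (\<lambda>(j, k). inner (from_nat_into Basis j) (blinfun_apply (g' i s) (from_nat_into Basis k))) \<in> Jacobian_limits f s"
      by (intro Jacobian_limit_of_patch[OF D _ De(2) fg g' cg']) (auto simp: I_def)
  next
    fix \<epsilon> :: real assume \<epsilon>: "\<epsilon> > 0"
    \<comment> \<open>Close to \<open>s\<close> no closure of an inactive patch is met, and the
      derivatives of active pieces are within \<open>\<epsilon>\<close> of their value at
      \<open>s\<close>. The latter is asked on the extensions \<open>De i\<close>, because a segment
      may leave the patch whose piece is being differentiated.\<close>
    define P where "P i z \<longleftrightarrow> (if i \<in> I then z \<in> De i \<and> norm (g' i z - g' i s) < \<epsilon> else z \<notin> closure (D i))" for i z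
    have "\<forall>\<^sub>F z in nhds s. P i z" if i: "i \<in> {..<r}" for i
    proof (cases "i \<in> I")
      case True
      have sDe: "s \<in> De i" using True De(2) i by (auto simp: I_def)
      have "\<forall>\<^sub>F z in nhds s. z \<in> De i" using De(1)[of i] sDe i by (auto intro: eventually_nhds_in_open)
      moreover have "isCont (g' i) s" using cg'[of i] De(1)[of i] sDe i by (auto simp: continuous_on_eq_continuous_at)
      then have "\<forall>\<^sub>F z in nhds s. dist (g' i z) (g' i s) < \<epsilon>"
        using \<epsilon> by (auto simp: isCont_def tendsto_at_iff_tendsto_nhds intro: tendstoD)
      ultimately show ?thesis by eventually_elim (use True in \<open>auto simp: P_def dist_norm\<close>)
    next
      case False
      then have "s \<in> - closure (D i)" using i by (auto simp: I_def)
      then have "\<forall>\<^sub>F z in nhds s. z \<in> - closure (D i)" by (intro eventually_nhds_in_open) auto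
      then show ?thesis by eventually_elim (use False in \<open>auto simp: P_def\<close>)
    qed
    then have "\<forall>\<^sub>F z in nhds s. \<forall>i\<in>{..<r}. P i z" by (intro eventually_ball_finite) auto
    then obtain \<delta> where \<delta>: "\<delta> > 0" "\<And>z i. dist z s < \<delta> \<Longrightarrow> i < r \<Longrightarrow> P i z"
      unfolding eventually_nhds_metric by blast
    have "\<exists>i\<in>I. inner l (f x - f y) \<le> inner l (blinfun_apply (g' i s) (x - y)) + \<epsilon> * norm l * norm (x - y)"
      if x: "x \<in> ball s \<delta>" and y: "y \<in> ball s \<delta>" for x y l
    proof -
      define z where "z t = y + t *\<^sub>R (x - y)" for t :: real
      have z: "dist (z t) s < \<delta>" if "t \<in> {0..1}" for t
      proof -
        have "z t = (1 - t) *\<^sub>R y + t *\<^sub>R x" by (simp add: z_def algebra_simps)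
        then have "z t \<in> ball s \<delta>" using convexD[OF convex_ball y x, of "1 - t" t] that by auto
        then show ?thesis by (simp add: dist_commute)
      qed
      have cz: "continuous_on A z" for A unfolding z_def by (intro continuous_intros)
      \<comment> \<open>Largest slope along the segment among the active derivatives; the index
        attaining it is the one claimed.\<close>
      define K where "K = Max ((\<lambda>i. inner l (blinfun_apply (g' i s) (x - y))) ` I)"
      have "inner l (f (z 1)) \<le> inner l (f (z 0)) + (K + \<epsilon> * norm l * norm (x - y))"
      proof (rule piecewise_mean_value[where C = "\<lambda>i. z -` closure (D i)" and v = "\<lambda>i t. inner l (g i (z t))"
            and v' = "\<lambda>i t. inner l (blinfun_apply (g' i (z t)) (x - y))", OF _ fin])
        show "continuous_on {0..1} (\<lambda>t. inner l (f (z t)))"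
          by (intro continuous_intros continuous_on_compose2[OF cf cz]) auto
        show "closed (z -` closure (D i))" for i
          by (intro closed_vimage closed_closure cz)
        show "{0..1} \<subseteq> (\<Union>i\<in>I. z -` closure (D i))"
        proof
          fix t :: real assume t: "t \<in> {0..1}"
          obtain i where i: "i < r" "z t \<in> closure (D i)" using cov by auto
          have "i \<in> I" using \<delta>(2)[OF z[OF t] i(1)] i(2) by (auto simp: P_def split: if_splits)
          with i show "t \<in> (\<Union>i\<in>I. z -` closure (D i))" by auto
        qed
      next
        fix i t assume i: "i \<in> I" and "t \<in> {0..1} \<inter> z -` closure (D i)"
        then show "inner l (f (z t)) = inner l (g i (z t))" using fg[of i "z t"] by (auto simp: I_def)
      next
        fix i t assume i: "i \<in> I" and t: "t \<in> {0..1 :: real}"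
        have ir: "i < r" using i by (simp add: I_def)
        have Pz: "z t \<in> De i" "norm (g' i (z t) - g' i s) < \<epsilon>"
          using \<delta>(2)[OF z[OF t] ir] i by (auto simp: P_def)
        have dz: "(z has_derivative (\<lambda>h. h *\<^sub>R (x - y))) (at t within {0..1})"
          unfolding z_def by (auto intro!: derivative_eq_intros)
        have "((\<lambda>t. g i (z t)) has_derivative (\<lambda>h. blinfun_apply (g' i (z t)) (h *\<^sub>R (x - y)))) (at t within {0..1})"
          by (rule has_derivative_compose[OF dz g'[OF ir Pz(1)]])
        then have "((\<lambda>t. inner l (g i (z t))) has_derivative (\<lambda>h. inner l (blinfun_apply (g' i (z t)) (h *\<^sub>R (x - y))))) (at t within {0..1})"
          by (intro derivative_intros)
        then show "((\<lambda>t. inner l (g i (z t))) has_real_derivative inner l (blinfun_apply (g' i (z t)) (x - y))) (at t within {0..1})"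
          by (simp add: has_field_derivative_def blinfun.scaleR_right mult_commute_abs)
        have "inner l (blinfun_apply (g' i (z t) - g' i s) (x - y)) \<le> norm l * (norm (g' i (z t) - g' i s) * norm (x - y))"
          by (rule order_trans[OF norm_cauchy_schwarz mult_left_mono[OF norm_blinfun]]) simp
        also have "\<dots> \<le> norm l * (\<epsilon> * norm (x - y))"
          using Pz by (intro mult_left_mono mult_right_mono) auto
        finally have "inner l (blinfun_apply (g' i (z t)) (x - y))
            \<le> inner l (blinfun_apply (g' i s) (x - y)) + \<epsilon> * norm l * norm (x - y)"
          by (simp add: blinfun.diff_left inner_diff_right algebra_simps)
        also have "inner l (blinfun_apply (g' i s) (x - y)) \<le> K"
          unfolding K_def using fin i by (intro Max_ge) auto
        finally show "inner l (blinfun_apply (g' i (z t)) (x - y)) \<le> K + \<epsilon> * norm l * norm (x - y)" by simp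
      qed
      then have "inner l (f x - f y) \<le> K + \<epsilon> * norm l * norm (x - y)"
        by (simp add: z_def inner_diff_right)
      moreover have "K \<in> (\<lambda>i. inner l (blinfun_apply (g' i s) (x - y))) ` I"
        unfolding K_def using fin ne by (intro Max_in) auto
      ultimately show ?thesis by auto
    qed
    with \<delta>(1) show "\<exists>\<delta>>0. \<forall>x\<in>ball s \<delta>. \<forall>y\<in>ball s \<delta>. \<forall>l. \<exists>i\<in>I.
      inner l (f x - f y) \<le> inner l (blinfun_apply (g' i s) (x - y)) + \<epsilon> * norm l * norm (x - y)" by blast
  qed
qed

section \<open>From matrices to operators\<close>

lemma inner_from_nat_into_Basis:
  assumes "i < DIM('a)" "j < DIM('a::euclidean_space)"
  shows "inner (from_nat_into Basis i :: 'a) (from_nat_into Basis j) = (if i = j then 1 else 0)"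
proof -
  have "bij_betw (from_nat_into Basis) {..<DIM('a)} (Basis :: 'a set)"
    by (rule bij_betw_from_nat_into_finite) simp
  then have "inj_on (from_nat_into (Basis :: 'a set)) {..<DIM('a)}" by (rule bij_betw_imp_inj_on)
  moreover have "from_nat_into Basis k \<in> (Basis :: 'a set)" for k by (rule from_nat_into) simp
  ultimately show ?thesis using assms by (auto simp: inner_Basis inj_on_def)
qed

locale orthonormal_frame =
  fixes c :: "nat \<Rightarrow> 'a::euclidean_space"
  assumes orthonormal: "\<And>i j. i < DIM('a) \<Longrightarrow> j < DIM('a) \<Longrightarrow> inner (c i) (c j) = (if i = j then 1 else 0)"
begin

lemma dim_span_frame:
  assumes "A \<subseteq> {..<DIM('a)}" shows "dim (span (c ` A)) = card A" "independent (c ` A)"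
proof -
  have inj: "inj_on c A"
  proof (rule inj_onI)
    fix i j assume "i \<in> A" "j \<in> A" "c i = c j"
    moreover from this assms have "i < DIM('a)" "j < DIM('a)" by auto
    ultimately show "i = j" using orthonormal[of i j] orthonormal[of i i] by (auto split: if_splits)
  qed
  show ind: "independent (c ` A)"
  proof (rule pairwise_orthogonal_independent)
    show "pairwise real_inner_class.orthogonal (c ` A)"
    proof (rule pairwiseI)
      fix a b assume "a \<in> c ` A" "b \<in> c ` A" and ab: "a \<noteq> b"
      then obtain i j where ij: "a = c i" "b = c j" "i \<in> A" "j \<in> A" by auto
      then have "i < DIM('a)" "j < DIM('a)" using assms by auto
      then show "real_inner_class.orthogonal a b"
        using orthonormal[of i j] ab ij by (auto simp: real_inner_class.orthogonal_def)
    qed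
    show "0 \<notin> c ` A"
    proof
      assume "0 \<in> c ` A"
      then obtain i where "i \<in> A" "c i = 0" by auto
      then show False using orthonormal[of i i] assms by auto
    qed
  qed
  show "dim (span (c ` A)) = card A"
    using dim_span_eq_card_independent[OF ind] card_image[OF inj] by simp
qed

text \<open>By dimension the frame spans the space. The difference of both sides is orthogonal to
  the frame, hence to itself.\<close>

lemma frame_expand: "v = (\<Sum>i<DIM('a). inner v (c i) *\<^sub>R c i)"
proof -
  define d where "d = v - (\<Sum>i<DIM('a). inner v (c i) *\<^sub>R c i)"
  have "span (c ` {..<DIM('a)}) = UNIV"
    using dim_span_frame(1)[of "{..<DIM('a)}"] by (simp add: dim_eq_full)
  then have "d \<in> span (c ` {..<DIM('a)})" by simp
  moreover have "inner d (c j) = 0" if "j < DIM('a)" for j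
  proof -
    have "inner (\<Sum>i<DIM('a). inner v (c i) *\<^sub>R c i) (c j) = (\<Sum>i<DIM('a). if i = j then inner v (c j) else 0)"
      unfolding inner_sum_left by (rule sum.cong) (use orthonormal that in auto)
    also have "\<dots> = inner v (c j)" using that by simp
    finally show ?thesis by (simp add: d_def inner_diff_left)
  qed
  ultimately have "real_inner_class.orthogonal d d"
    by (intro orthogonal_to_span[of d]) (auto simp: real_inner_class.orthogonal_def)
  then show ?thesis by (simp add: d_def real_inner_class.orthogonal_self)
qed

lemma frame_eqI:
  assumes "\<And>i. i < DIM('a) \<Longrightarrow> inner v (c i) = inner w (c i)" shows "v = w"
  by (subst frame_expand, subst (2) frame_expand) (use assms in simp)

lemma frame_inner: "inner v w = (\<Sum>i<DIM('a). inner v (c i) * inner w (c i))"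
proof -
  have "inner v w = inner v (\<Sum>i<DIM('a). inner w (c i) *\<^sub>R c i)"
    using frame_expand[of w] by simp
  then show ?thesis by (simp add: inner_sum_right mult.commute)
qed

end

text \<open>The frame is formed by the columns of \<open>Q\<close>, read as vectors in the
  enumerated basis. Conjugation by \<open>Q\<close> thus becomes evaluation of the operator on the
  frame, and the enumeration disappears from what follows.\<close>

lemma orthonormal_mat_frame:
  fixes Q :: "real mat"
  assumes Q: "orthonormal_mat DIM('a::euclidean_space) Q"
  obtains c :: "nat \<Rightarrow> 'a::euclidean_space" where "orthonormal_frame c"
    "\<And>\<Lambda> j k. linear \<Lambda> \<Longrightarrow> j < DIM('a) \<Longrightarrow> k < DIM('a) \<Longrightarrow>
      (transpose_mat Q * Matrix.mat DIM('a) DIM('a)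
        (\<lambda>(i, j). inner (from_nat_into Basis i) (\<Lambda> (from_nat_into Basis j))) * Q) $$ (j, k) = inner (c j) (\<Lambda> (c k))"
proof -
  let ?N = "DIM('a)"
  let ?e = "from_nat_into (Basis :: 'a set)"
  have Qc: "Q \<in> carrier_mat ?N ?N" and QQ: "transpose_mat Q * Q = 1\<^sub>m ?N"
    using Q by (auto simp: orthonormal_mat_def)
  define c where "c j = (\<Sum>i<?N. Q $$ (i, j) *\<^sub>R ?e i)" for j
  have *: "(transpose_mat Q * Matrix.mat ?N ?N (\<lambda>(i, j). inner (?e i) (\<Lambda> (?e j))) * Q) $$ (j, k)
      = inner (c j) (\<Lambda> (c k))" if lin: "linear \<Lambda>" and jk: "j < ?N" "k < ?N" for \<Lambda> :: "'a \<Rightarrow> 'a" and j k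
  proof -
    let ?M = "Matrix.mat ?N ?N (\<lambda>(i, j). inner (?e i) (\<Lambda> (?e j)))"
    have "(transpose_mat Q * ?M * Q) $$ (j, k) = (\<Sum>l<?N. (\<Sum>i<?N. Q $$ (i, j) * inner (?e i) (\<Lambda> (?e l))) * Q $$ (l, k))"
      using Qc jk by (simp add: scalar_prod_def lessThan_atLeast0)
    also have "\<dots> = (\<Sum>i<?N. \<Sum>l<?N. Q $$ (i, j) * inner (?e i) (\<Lambda> (?e l)) * Q $$ (l, k))"
      by (subst sum.swap) (simp add: sum_distrib_right)
    also have "\<dots> = inner (c j) (\<Lambda> (c k))"
      by (simp add: c_def linear_sum[OF lin] linear_cmul[OF lin] inner_sum_left inner_sum_right
          sum_distrib_left, subst sum.swap, simp add: mult_ac)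
    finally show ?thesis .
  qed
  have "orthonormal_frame c"
  proof
    fix j k assume jk: "j < ?N" "k < ?N"
    \<comment> \<open>Orthonormality is the instance of \<open>*\<close> for the identity operator,
      whose matrix is \<open>1\<^sub>m ?N\<close>.\<close>
    have 1: "Matrix.mat ?N ?N (\<lambda>(i, j). inner (?e i) (?e j)) = 1\<^sub>m ?N"
      by (rule eq_matI) (auto simp: inner_from_nat_into_Basis)
    show "inner (c j) (c k) = (if j = k then 1 else 0)"
      using *[OF linear_id jk] jk Qc by (simp add: 1 QQ right_mult_one_mat[of _ ?N ?N])
  qed
  then show ?thesis by (rule that[OF _ *])
qed

section \<open>The Lyapunov inequality in frame coordinates\<close>

lemma scalar_prod_sum: "dim_vec w = n \<Longrightarrow> scalar_prod v w = (\<Sum>i<n. v $ i * w $ i)"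
  by (simp add: scalar_prod_def lessThan_atLeast0)

lemma sum_lessThan_add:
  fixes g :: "nat \<Rightarrow> 'a::comm_monoid_add"
  shows "(\<Sum>i<p + q. g i) = (\<Sum>i<p. g i) + (\<Sum>j<q. g (p + j))"
  by (induction q) (auto simp: add.assoc)

text \<open>\<open>G\<close> is the identity on the span of the first \<open>p\<close> frame vectors
  and acts as \<open>P\<close> on the last \<open>q\<close>; \<open>\<pi>\<close> is the orthogonal
  projection onto the span of the latter. On that span \<open>inner (G w) (\<Lambda> w)\<close> is
  half the quadratic form of \<open>transpose_mat B * P + P * B\<close>. Both operators are fixed
  before \<open>\<Lambda>\<close>, so they serve all limiting Jacobians at once.\<close>

lemma lyapunov_operators:
  fixes Q P :: "real mat"
  assumes p: "p \<le> DIM('a::euclidean_space)" and q: "q = DIM('a::euclidean_space) - p"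
    and Q: "orthonormal_mat DIM('a::euclidean_space) Q" and P: "pos_def_mat q P"
  obtains G \<pi> :: "'a::euclidean_space \<Rightarrow> 'a" where
    "linear G" "\<And>v w. inner (G v) w = inner v (G w)" "\<And>v. v \<noteq> 0 \<Longrightarrow> inner (G v) v > 0"
    "linear \<pi>" "\<And>v. \<pi> (\<pi> v) = \<pi> v" "dim {v. \<pi> v = 0} = p"
    "\<And>e v. \<pi> e = 0 \<Longrightarrow> inner (G e) (\<pi> v) = 0"
    "\<And>\<Lambda> B. linear \<Lambda> \<Longrightarrow> B \<in> carrier_mat q q \<Longrightarrow>
      transpose_mat Q * Matrix.mat DIM('a) DIM('a)
        (\<lambda>(i, j). inner (from_nat_into Basis i) (\<Lambda> (from_nat_into Basis j))) * Q = zero_block p q B \<Longrightarrow>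
      neg_def_mat q (transpose_mat B * P + P * B) \<Longrightarrow>
      (\<forall>e. \<pi> e = 0 \<longrightarrow> \<Lambda> e = 0) \<and> (\<forall>w. \<pi> w = w \<longrightarrow> w \<noteq> 0 \<longrightarrow> inner (G w) (\<Lambda> w) < 0)"
proof -
  let ?N = "DIM('a)"
  have N: "?N = p + q" using p q by simp
  obtain c :: "nat \<Rightarrow> 'a" where fr: "orthonormal_frame c" and
    QMQ: "\<And>\<Lambda> j k. linear \<Lambda> \<Longrightarrow> j < ?N \<Longrightarrow> k < ?N \<Longrightarrow>
      (transpose_mat Q * Matrix.mat ?N ?N
        (\<lambda>(i, j). inner (from_nat_into Basis i) (\<Lambda> (from_nat_into Basis j))) * Q) $$ (j, k) = inner (c j) (\<Lambda> (c k))"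
    using orthonormal_mat_frame[OF Q] by metis
  interpret orthonormal_frame c by (rule fr)
  have Pc: "P \<in> carrier_mat q q" and PT: "transpose_mat P = P"
    and Ppos: "\<And>v. v \<in> carrier_vec q \<Longrightarrow> v \<noteq> 0\<^sub>v q \<Longrightarrow> scalar_prod v (P *\<^sub>v v) > 0"
    using P by (auto simp: pos_def_mat_def)
  have Psym: "P $$ (j, k) = P $$ (k, j)" if "j < q" "k < q" for j k
    using that Pc PT by (metis carrier_matD index_transpose_mat(1))
  \<comment> \<open>The last \<open>q\<close> coordinates, the only ones that \<open>P\<close> and
    \<open>B\<close> see.\<close>
  define x where "x v = Matrix.vec q (\<lambda>j. inner v (c (p + j)))" for v
  have xc: "x v \<in> carrier_vec q" for v by (simp add: x_def)
  define G where "G v = (\<Sum>i<p. inner v (c i) *\<^sub>R c i) + (\<Sum>j<q. (P *\<^sub>v x v) $ j *\<^sub>R c (p + j))" for v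
  define \<pi> where "\<pi> v = (\<Sum>j<q. inner v (c (p + j)) *\<^sub>R c (p + j))" for v
  have Gin: "inner (G v) w = (\<Sum>i<p. inner v (c i) * inner w (c i)) + scalar_prod (P *\<^sub>v x v) (x w)" for v w
    using Pc by (simp add: G_def inner_add_left inner_sum_left scalar_prod_sum[where n = q] x_def inner_commute[of w])
  have \<pi>1: "inner (\<pi> v) (c i) = 0" if "i < p" for v i
    unfolding \<pi>_def inner_sum_left by (rule sum.neutral) (use that orthonormal N in auto)
  have \<pi>2: "inner (\<pi> v) (c (p + j)) = inner v (c (p + j))" if j: "j < q" for v j
  proof -
    have "inner (\<pi> v) (c (p + j)) = (\<Sum>k<q. if k = j then inner v (c (p + j)) else 0)"
      unfolding \<pi>_def inner_sum_left by (rule sum.cong) (use orthonormal N j in auto)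
    then show ?thesis using j by simp
  qed
  have \<pi>0: "\<pi> v = 0 \<longleftrightarrow> (\<forall>j<q. inner v (c (p + j)) = 0)" for v
    using \<pi>2[of _ v] by (auto simp: \<pi>_def)
  have x0: "x v = 0\<^sub>v q \<longleftrightarrow> \<pi> v = 0" for v
    unfolding \<pi>0 by (auto simp: x_def vec_eq_iff)
  show ?thesis
  proof (rule that[of G \<pi>])
    have xadd: "x (v + w) = x v + x w" and xscale: "x (a *\<^sub>R v) = a \<cdot>\<^sub>v x v" for v w a
      by (auto simp: x_def inner_add_left)
    show "linear G"
    proof (rule linearI)
      fix v w :: 'a and a :: real
      show "G (v + w) = G v + G w"
        using Pc by (simp add: G_def xadd mult_add_distrib_mat_vec[OF Pc xc xc] inner_add_left scaleR_add_left sum.distrib)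
      show "G (a *\<^sub>R v) = a *\<^sub>R G v"
        using Pc by (simp add: G_def xscale mult_mat_vec[OF Pc xc] scaleR_right.sum scaleR_add_right)
    qed
    show "linear \<pi>"
      unfolding \<pi>_def by (rule linearI) (simp_all add: inner_add_left scaleR_add_left sum.distrib scaleR_right.sum)
    show "inner (G v) w = inner v (G w)" for v w
      unfolding inner_commute[of v] Gin using transpose_vec_mult_scalar[OF Pc xc xc, of v w]
      by (simp add: PT comm_scalar_prod[OF xc mult_mat_vec_carrier[OF Pc xc]] mult.commute)
    show "inner (G v) v > 0" if v: "v \<noteq> 0" for v
    proof (cases "\<pi> v = 0")
      case True
      then have "inner v v = (\<Sum>i<p. inner v (c i) * inner v (c i))"
        unfolding frame_inner[of v v] N sum_lessThan_add by (simp add: \<pi>0)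
      moreover have "x v = 0\<^sub>v q" using True by (simp add: x0)
      ultimately have "inner (G v) v = inner v v"
        using Pc by (simp add: Gin scalar_prod_sum[where n = q])
      then show ?thesis using v by simp
    next
      case False
      then have "scalar_prod (x v) (P *\<^sub>v x v) > 0" using Ppos[OF xc] x0 by blast
      then show ?thesis
        by (simp add: Gin comm_scalar_prod[OF mult_mat_vec_carrier[OF Pc xc] xc] add_nonneg_pos sum_nonneg)
    qed
    show "\<pi> (\<pi> v) = \<pi> v" for v
      unfolding \<pi>_def[of "\<pi> v"] by (simp add: \<pi>2) (simp add: \<pi>_def)
    show "inner (G e) (\<pi> v) = 0" if "\<pi> e = 0" for e v
    proof -
      have "x e = 0\<^sub>v q" using that by (simp add: x0)
      then show ?thesis using Pc by (simp add: Gin \<pi>1 scalar_prod_sum[where n = q] x_def[of "\<pi> v"])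
    qed
    have "{v. \<pi> v = 0} = span (c ` {..<p})"
    proof
      show "{v. \<pi> v = 0} \<subseteq> span (c ` {..<p})"
      proof
        fix v assume "v \<in> {v. \<pi> v = 0}"
        then have "v = (\<Sum>i<p. inner v (c i) *\<^sub>R c i)"
          using frame_expand[of v] unfolding N sum_lessThan_add by (simp add: \<pi>0)
        moreover have "\<dots> \<in> span (c ` {..<p})" by (intro span_sum span_scale span_base) auto
        ultimately show "v \<in> span (c ` {..<p})" by simp
      qed
      show "span (c ` {..<p}) \<subseteq> {v. \<pi> v = 0}"
      proof (rule span_minimal)
        show "c ` {..<p} \<subseteq> {v. \<pi> v = 0}" using orthonormal N by (auto simp: \<pi>0)
        show "subspace {v. \<pi> v = 0}" by (auto simp: subspace_def \<pi>0 inner_add_left)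
      qed
    qed
    then show "dim {v. \<pi> v = 0} = p" using dim_span_frame(1)[of "{..<p}"] p by simp
  next
    fix \<Lambda> :: "'a \<Rightarrow> 'a" and B
    assume lin: "linear \<Lambda>" and Bc: "B \<in> carrier_mat q q"
      and block: "transpose_mat Q * Matrix.mat ?N ?N
        (\<lambda>(i, j). inner (from_nat_into Basis i) (\<Lambda> (from_nat_into Basis j))) * Q = zero_block p q B"
      and neg: "neg_def_mat q (transpose_mat B * P + P * B)"
    have entry: "inner (c j) (\<Lambda> (c k)) = zero_block p q B $$ (j, k)" if "j < ?N" "k < ?N" for j k
      using QMQ[OF lin that] block by simp
    \<comment> \<open>The first \<open>p\<close> columns of the block matrix vanish, so the common
      kernel contains the first \<open>p\<close> frame vectors.\<close>
    have z1: "\<Lambda> (c k) = 0" if "k < p" for k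
      by (rule frame_eqI) (use entry[of _ k] that N Bc in \<open>auto simp: zero_block_def inner_commute\<close>)
    have z2: "inner (\<Lambda> (c (p + k))) (c i) = 0" if "i < p" "k < q" for i k
      using entry[of i "p + k"] that N Bc by (auto simp: zero_block_def inner_commute)
    have z3: "inner (\<Lambda> (c (p + k))) (c (p + j)) = B $$ (j, k)" if "j < q" "k < q" for j k
      using entry[of "p + j" "p + k"] that N Bc by (auto simp: zero_block_def inner_commute)
    have \<Lambda>: "\<Lambda> v = (\<Sum>k<q. inner v (c (p + k)) *\<^sub>R \<Lambda> (c (p + k)))" for v
    proof -
      have "\<Lambda> v = \<Lambda> (\<Sum>i<?N. inner v (c i) *\<^sub>R c i)" using frame_expand[of v] by simp
      then show ?thesis
        unfolding N sum_lessThan_add by (simp add: linear_add[OF lin] linear_sum[OF lin] linear_cmul[OF lin] z1)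
    qed
    have x\<Lambda>: "x (\<Lambda> v) = B *\<^sub>v x v" for v
    proof (rule eq_vecI)
      fix j assume "j < dim_vec (B *\<^sub>v x v)"
      then have j: "j < q" using Bc by simp
      have "x (\<Lambda> v) $ j = (\<Sum>k<q. inner v (c (p + k)) * B $$ (j, k))"
        using j by (simp add: x_def \<Lambda>[of v] inner_sum_left z3)
      also have "\<dots> = (B *\<^sub>v x v) $ j"
        using j Bc by (simp add: scalar_prod_sum[where n = q] x_def mult.commute)
      finally show "x (\<Lambda> v) $ j = (B *\<^sub>v x v) $ j" .
    qed (use Bc in \<open>simp add: x_def\<close>)
    show "(\<forall>e. \<pi> e = 0 \<longrightarrow> \<Lambda> e = 0) \<and> (\<forall>w. \<pi> w = w \<longrightarrow> w \<noteq> 0 \<longrightarrow> inner (G w) (\<Lambda> w) < 0)"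
    proof (intro conjI allI impI)
      fix e assume "\<pi> e = 0"
      then show "\<Lambda> e = 0" by (simp add: \<Lambda>[of e] \<pi>0)
    next
      fix w assume w: "\<pi> w = w" "w \<noteq> 0"
      then have "x w \<noteq> 0\<^sub>v q" by (simp add: x0)
      then have "scalar_prod (x w) ((transpose_mat B * P + P * B) *\<^sub>v x w) < 0"
        using neg xc by (simp add: neg_def_mat_def)
      \<comment> \<open>Moving \<open>transpose_mat B\<close> and the symmetric \<open>P\<close>
        across the scalar product makes both summands equal.\<close>
      moreover have "scalar_prod (x w) ((transpose_mat B * P + P * B) *\<^sub>v x w)
          = 2 * scalar_prod (P *\<^sub>v x w) (B *\<^sub>v x w)"
      proof -
        have Px: "P *\<^sub>v x w \<in> carrier_vec q" and Bx: "B *\<^sub>v x w \<in> carrier_vec q"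
          using Pc Bc xc by (auto intro: mult_mat_vec_carrier)
        have "(transpose_mat B * P + P * B) *\<^sub>v x w = transpose_mat B *\<^sub>v (P *\<^sub>v x w) + P *\<^sub>v (B *\<^sub>v x w)"
          using Pc Bc xc[of w] by (simp add: add_mult_distrib_mat_vec[of _ q q])
        moreover have "scalar_prod (x w) (transpose_mat B *\<^sub>v (P *\<^sub>v x w)) = scalar_prod (P *\<^sub>v x w) (B *\<^sub>v x w)"
          using transpose_vec_mult_scalar[OF Bc xc Px, of w] comm_scalar_prod[OF xc, of "transpose_mat B *\<^sub>v (P *\<^sub>v x w)" w] Bc Px
          by (simp add: mult_mat_vec_carrier[of _ q q])
        moreover have "scalar_prod (x w) (P *\<^sub>v (B *\<^sub>v x w)) = scalar_prod (P *\<^sub>v x w) (B *\<^sub>v x w)"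
          using transpose_vec_mult_scalar[OF Pc Bx xc, of w] by (simp add: PT)
        ultimately show ?thesis
          using Pc Bc Px Bx xc[of w] by (simp add: scalar_prod_add_distrib[of _ q] mult_mat_vec_carrier[of _ q q])
      qed
      moreover have "inner w (c i) = 0" if "i < p" for i using \<pi>1[OF that, of w] w by simp
      then have "inner (G w) (\<Lambda> w) = scalar_prod (P *\<^sub>v x w) (B *\<^sub>v x w)"
        by (simp add: Gin x\<Lambda>)
      ultimately show "inner (G w) (\<Lambda> w) < 0" by simp
    qed
  qed
qed

section \<open>Tangent spaces of the equilibrium manifold\<close>

text \<open>Inside a chart domain \<open>S\<close> is the preimage of the closed set
  \<open>T\<close>, so \<open>S\<close> meets small closed balls in closed sets even if
  \<open>S\<close> itself is not closed.\<close>

lemma submanifold_locally_compact: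
  fixes S :: "'a::euclidean_space set"
  assumes "submanifold_dim p S" "s \<in> S"
  obtains r where "r > 0" "\<And>r'. r' \<le> r \<Longrightarrow> compact (S \<inter> cball s r')"
proof -
  obtain U V \<phi> \<psi> T where U: "open U" "s \<in> U" and hom: "homeomorphism U V \<phi> \<psi>"
    and T: "subspace (T :: 'a set)" and SU: "\<phi> ` (U \<inter> S) = V \<inter> T"
    using assms unfolding submanifold_dim_def by metis
  obtain r where r: "r > 0" "cball s r \<subseteq> U" using U open_contains_cball by blast
  have "compact (S \<inter> cball s r')" if "r' \<le> r" for r'
  proof -
    have sub: "cball s r' \<subseteq> U" using r(2) that by auto
    have "S \<inter> cball s r' = cball s r' \<inter> \<phi> -` T"
    proof (intro equalityI subsetI)
      fix x assume x: "x \<in> cball s r' \<inter> \<phi> -` T"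
      then have xU: "x \<in> U" using sub by auto
      then have "\<phi> x \<in> V \<inter> T" using x hom by (auto simp: homeomorphism_def)
      then obtain y where y: "y \<in> U \<inter> S" "\<phi> x = \<phi> y" using SU by (metis imageE)
      then have "x = y" using xU hom by (metis IntE homeomorphism_apply1)
      then show "x \<in> S \<inter> cball s r'" using x y by auto
    qed (use SU sub in blast)
    moreover have "closed (cball s r' \<inter> \<phi> -` T)"
      by (intro continuous_closed_preimage closed_cball closed_subspace T
          continuous_on_subset[OF homeomorphism_cont1[OF hom] sub])
    ultimately show ?thesis by (metis compact_eq_bounded_closed bounded_Int bounded_cball)
  qed
  with r(1) show ?thesis by (rule that)
qed

text \<open>The image of \<open>T\<close> under the derivative of the inverse chart; the curves are
  images of straight lines in \<open>T\<close>. The chain rule for \<open>\<phi>\<close> after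
  \<open>\<psi>\<close> makes that derivative injective, so the dimension is kept. Curves are
  recorded because the cone condition and the minimality are both tested along them.\<close>

lemma submanifold_tangent_space:
  fixes S :: "'a::euclidean_space set"
  assumes "submanifold_dim p S" "s \<in> S"
  obtains Tn :: "'a set" where "subspace Tn" "dim Tn = p"
    "\<And>v. v \<in> Tn \<Longrightarrow> \<exists>c::real \<Rightarrow> 'a. c 0 = s \<and> (c has_vector_derivative v) (at 0) \<and> (\<forall>\<^sub>F t in nhds 0. c t \<in> S)"
proof -
  obtain U V \<phi> \<psi> T where U: "open U" "s \<in> U" and V: "open V" and hom: "homeomorphism U V \<phi> \<psi>"
    and C1: "C1_on \<phi> U" "C1_on \<psi> V"
    and T: "subspace (T :: 'a set)" "dim T = p" and SU: "\<phi> ` (U \<inter> S) = V \<inter> T"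
    using assms unfolding submanifold_dim_def by metis
  define z where "z = \<phi> s"
  have z: "z \<in> V" "z \<in> T" and \<psi>z: "\<psi> z = s"
    using SU U assms(2) homeomorphism_apply1[OF hom] by (auto simp: z_def)
  obtain \<phi>' \<psi>' where \<phi>': "(\<phi> has_derivative \<phi>') (at s)" and \<psi>': "(\<psi> has_derivative \<psi>') (at z)"
    using C1 U(2) z(1) unfolding C1_on_def by blast
  have "((\<lambda>x. \<phi> (\<psi> x)) has_derivative (\<lambda>h. \<phi>' (\<psi>' h))) (at z)"
    by (rule has_derivative_compose[OF \<psi>']) (simp add: \<psi>z \<phi>')
  then have "((\<lambda>x. x) has_derivative (\<lambda>h. \<phi>' (\<psi>' h))) (at z)"
    by (rule has_derivative_transform_within_open[OF _ V z(1)]) (simp add: homeomorphism_apply2[OF hom])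
  from has_derivative_unique[OF this has_derivative_ident]
  have inv: "\<phi>' (\<psi>' h) = h" for h by metis
  have lin: "linear \<psi>'" using \<psi>' has_derivative_linear by blast
  have inj: "inj_on \<psi>' (span T)" by (rule inj_on_inverseI[of _ \<phi>']) (rule inv)
  show ?thesis
  proof (rule that[of "\<psi>' ` T"])
    show "subspace (\<psi>' ` T)" by (rule linear_subspace_image[OF lin T(1)])
    show "dim (\<psi>' ` T) = p" using eucl.dim_image_eq[OF lin inj] T(2) by simp
    fix v assume "v \<in> \<psi>' ` T"
    then obtain w where w: "w \<in> T" "v = \<psi>' w" by auto
    define c where "c t = \<psi> (z + t *\<^sub>R w)" for t :: real
    have "((\<lambda>t. z + t *\<^sub>R w) has_derivative (\<lambda>h. h *\<^sub>R w)) (at 0)"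
      by (auto intro!: derivative_eq_intros)
    then have "(c has_derivative (\<lambda>h. \<psi>' (h *\<^sub>R w))) (at 0)"
      unfolding c_def by (rule has_derivative_compose) (simp add: \<psi>')
    then have "(c has_vector_derivative v) (at 0)"
      by (simp add: has_vector_derivative_def linear_cmul[OF lin] w(2))
    moreover have "\<forall>\<^sub>F t in nhds 0. c t \<in> S"
    proof -
      have "isCont (\<lambda>t. z + t *\<^sub>R w) 0" by (intro continuous_intros)
      then have "((\<lambda>t. z + t *\<^sub>R w) \<longlongrightarrow> z) (nhds 0)" using tendsto_at_iff_tendsto_nhds[of "\<lambda>t. z + t *\<^sub>R w" 0] by (simp add: isCont_def)
      then have "\<forall>\<^sub>F t in nhds 0. z + t *\<^sub>R w \<in> V" using V z(1) by (rule topological_tendstoD)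
      then show ?thesis
      proof eventually_elim
        case (elim t)
        moreover have "z + t *\<^sub>R w \<in> T" using T(1) z(2) w(1) by (simp add: subspace_add subspace_scale)
        ultimately have "z + t *\<^sub>R w \<in> \<phi> ` (U \<inter> S)" using SU by simp
        then show ?case using homeomorphism_apply1[OF hom] by (auto simp: c_def)
      qed
    qed
    ultimately show "\<exists>c::real \<Rightarrow> 'a. c 0 = s \<and> (c has_vector_derivative v) (at 0) \<and> (\<forall>\<^sub>F t in nhds 0. c t \<in> S)"
      using \<psi>z by (intro exI[of _ c]) (simp add: c_def)
  qed
qed

text \<open>The cone is closed and invariant under scaling: secants of the curve lie in it, hence so
  does their limit direction.\<close>

lemma tangent_in_cone:
  fixes c :: "real \<Rightarrow> 'a::euclidean_space"
  assumes dc: "(c has_vector_derivative v) (at 0)" and lin: "linear \<pi>"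
    and cone: "\<forall>\<^sub>F t in nhds 0. norm (\<pi> (c t - c 0)) \<le> \<eta> * norm (c t - c 0)" and \<eta>: "\<eta> \<ge> 0"
  shows "norm (\<pi> v) \<le> \<eta> * norm v"
proof -
  obtain C where C: "C > 0" "\<And>x. norm (\<pi> x) \<le> C * norm x" using linear_bounded_pos[OF lin] by blast
  show ?thesis
  proof (rule field_le_epsilon)
    fix e :: real assume e: "e > 0"
    \<comment> \<open>The remainder of the linear approximation enters once through
      \<open>\<pi>\<close> with factor \<open>C\<close> and once through the cone bound with factor
      \<open>\<eta>\<close>.\<close>
    define e' where "e' = e / (C + \<eta>)"
    have e': "e' > 0" "(C + \<eta>) * e' = e" using e C \<eta> by (simp_all add: e'_def)
    obtain d1 where d1: "d1 > 0" "\<And>t. \<bar>t\<bar> < d1 \<Longrightarrow> norm (c t - c 0 - t *\<^sub>R v) \<le> e' * \<bar>t\<bar>"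
      using dc e'(1) unfolding has_vector_derivative_def has_derivative_at_alt real_norm_def by (metis diff_zero)
    obtain d2 where d2: "d2 > 0" "\<And>t. \<bar>t\<bar> < d2 \<Longrightarrow> norm (\<pi> (c t - c 0)) \<le> \<eta> * norm (c t - c 0)"
      using cone unfolding eventually_nhds_metric dist_real_def by (metis diff_zero)
    define t where "t = min d1 d2 / 2"
    have t: "t > 0" "\<bar>t\<bar> < d1" "\<bar>t\<bar> < d2" using d1(1) d2(1) by (auto simp: t_def min_def)
    let ?\<rho> = "c t - c 0 - t *\<^sub>R v"
    have "t *\<^sub>R \<pi> v = \<pi> (c t - c 0) - \<pi> ?\<rho>" by (simp add: linear_diff[OF lin] linear_cmul[OF lin])
    then have "t * norm (\<pi> v) = norm (\<pi> (c t - c 0) - \<pi> ?\<rho>)" using t by (metis abs_of_pos norm_scaleR)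
    also have "\<dots> \<le> norm (\<pi> (c t - c 0)) + norm (\<pi> ?\<rho>)" by (rule norm_triangle_ineq4)
    also have "\<dots> \<le> \<eta> * norm (c t - c 0) + C * norm ?\<rho>" by (intro add_mono d2(2) t C(2))
    also have "\<dots> \<le> \<eta> * (t * norm v + norm ?\<rho>) + C * norm ?\<rho>"
      using norm_triangle_sub[of "c t - c 0" "t *\<^sub>R v"] t \<eta> by (simp add: mult_left_mono)
    also have "\<dots> = t * (\<eta> * norm v) + (C + \<eta>) * norm ?\<rho>" by (simp add: algebra_simps)
    also have "\<dots> \<le> t * (\<eta> * norm v) + (C + \<eta>) * (e' * t)"
      using d1(2)[OF t(2)] t C \<eta> by (intro add_left_mono mult_left_mono) auto
    also have "\<dots> = t * (\<eta> * norm v + e)" unfolding mult.assoc[symmetric] e'(2) by (simp add: algebra_simps)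
    finally have "t * norm (\<pi> v) \<le> t * (\<eta> * norm v + e)" .
    then show "norm (\<pi> v) \<le> \<eta> * norm v + e" using t by simp
  qed
qed

lemma (in energy_form) minimizer_orthogonal_tangent:
  assumes dc: "(c has_vector_derivative v) (at 0)"
    and min: "\<forall>\<^sub>F t in nhds 0. energy G (x - c 0) \<le> energy G (x - c t)"
  shows "inner (G (x - c 0)) v = 0"
proof -
  have "((\<lambda>t. x - c t) has_vector_derivative - v) (at 0)"
    using has_vector_derivative_diff[OF has_vector_derivative_const dc] by simp
  from energy_has_derivative[OF this]
  have "((\<lambda>t. energy G (x - c t)) has_real_derivative 2 * inner (G (x - c 0)) (- v)) (at 0)" .
  moreover obtain d where "d > 0" "\<And>t. \<bar>t\<bar> < d \<Longrightarrow> energy G (x - c 0) \<le> energy G (x - c t)"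
    using min unfolding eventually_nhds_metric dist_real_def by (metis diff_zero)
  ultimately have "2 * inner (G (x - c 0)) (- v) = 0"
    by (intro DERIV_local_min) auto
  then show ?thesis by simp
qed

text \<open>On the cone \<open>v - \<pi> v\<close> cannot vanish unless \<open>v\<close> does, so
  this map embeds \<open>Tn\<close> into the kernel of \<open>\<pi>\<close>, and equal dimensions
  make it onto. Hence \<open>Tn\<close> is a graph over the kernel, and
  \<open>norm v \<le> 2 * norm e\<close> turns \<open>\<eta>\<close> into the slope
  \<open>2 * \<eta>\<close>.\<close>

lemma graph_over_kernel:
  fixes \<pi> :: "'a::euclidean_space \<Rightarrow> 'a"
  assumes lin: "linear \<pi>" and idem: "\<And>v. \<pi> (\<pi> v) = \<pi> v" and Tn: "subspace Tn" "dim Tn = dim {v. \<pi> v = 0}"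
    and cone: "\<And>v. v \<in> Tn \<Longrightarrow> norm (\<pi> v) \<le> \<eta> * norm v" and \<eta>: "0 \<le> \<eta>" "\<eta> \<le> 1 / 2"
    and e: "\<pi> e = 0"
  shows "\<exists>v\<in>Tn. norm (e - v) \<le> 2 * \<eta> * norm e"
proof -
  define h where "h v = v - \<pi> v" for v
  have hl: "linear h" unfolding h_def by (intro linear_compose_sub linear_ident lin)
  have "inj_on h (span Tn)"
  proof (subst linear_inj_on_iff_eq_0[OF hl subspace_span], intro ballI impI)
    fix v assume "v \<in> span Tn" "h v = 0"
    moreover from this have "v \<in> Tn" using Tn(1) span_eq_iff by blast
    ultimately have "norm v \<le> \<eta> * norm v" using cone[of v] by (simp add: h_def)
    also have "\<dots> \<le> 1 / 2 * norm v" using \<eta> by (intro mult_right_mono) auto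
    finally show "v = 0" by simp
  qed
  then have dimh: "dim (h ` Tn) = dim {v. \<pi> v = 0}" using eucl.dim_image_eq[OF hl] Tn(2) by simp
  have "h ` Tn = {v. \<pi> v = 0}"
  proof (rule subspace_dim_equal)
    show "subspace (h ` Tn)" by (rule linear_subspace_image[OF hl Tn(1)])
    show "subspace {v. \<pi> v = 0}" by (rule linear_subspace_kernel[OF lin])
    show "h ` Tn \<subseteq> {v. \<pi> v = 0}" by (auto simp: h_def linear_diff[OF lin] idem)
  qed (simp add: dimh)
  then obtain v where v: "v \<in> Tn" "e = v - \<pi> v" using e unfolding h_def by blast
  have "norm v \<le> norm e + norm (\<pi> v)" using norm_triangle_ineq[of e "\<pi> v"] v(2) by simp
  also have "norm (\<pi> v) \<le> 1 / 2 * norm v"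
    by (rule order_trans[OF cone[OF v(1)] mult_right_mono]) (use \<eta> in auto)
  finally have "norm v \<le> 2 * norm e" by simp
  then have "norm (e - v) \<le> \<eta> * (2 * norm e)"
    using order_trans[OF cone[OF v(1)] mult_left_mono[OF _ \<eta>(1)]] v(2) by simp
  then show ?thesis using v(1) by (intro bexI[of _ v]) (simp_all add: mult_ac)
qed

text \<open>The form is continuous and negative on the compact unit sphere of the range of
  \<open>\<pi>\<close>; homogeneity extends the bound, and a minimum over the finite index set makes
  it uniform.\<close>

lemma negative_form_bound:
  fixes G \<pi> :: "'a::euclidean_space \<Rightarrow> 'a" and \<Lambda> :: "nat \<Rightarrow> 'a \<Rightarrow>\<^sub>L 'a"
  assumes G: "bounded_linear G" and \<pi>: "linear \<pi>" and fin: "finite I"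
    and neg: "\<And>i w. i \<in> I \<Longrightarrow> \<pi> w = w \<Longrightarrow> w \<noteq> 0 \<Longrightarrow> inner (G w) (blinfun_apply (\<Lambda> i) w) < 0"
  shows "\<exists>c>0. \<forall>i\<in>I. \<forall>w. \<pi> w = w \<longrightarrow> inner (G w) (blinfun_apply (\<Lambda> i) w) \<le> - c * (norm w)\<^sup>2"
proof -
  have single: "\<exists>c>0. \<forall>w. \<pi> w = w \<longrightarrow> inner (G w) (blinfun_apply (\<Lambda> i) w) \<le> - c * (norm w)\<^sup>2" if i: "i \<in> I" for i
  proof -
    define A where "A = sphere 0 1 \<inter> {w. \<pi> w = w}"
    define g where "g w = inner (G w) (blinfun_apply (\<Lambda> i) w)" for w
    have cg: "continuous_on X g" for X
      unfolding g_def by (intro continuous_intros bounded_linear.continuous_on[OF G])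
    have "subspace {w. \<pi> w - w = 0}"
      by (rule linear_subspace_kernel) (intro linear_compose_sub linear_ident \<pi>)
    then have "compact A" unfolding A_def by (intro compact_Int_closed closed_subspace) simp_all
    obtain c where c: "c > 0" "\<And>w. w \<in> A \<Longrightarrow> g w \<le> - c"
    proof (cases "A = {}")
      case False
      then obtain w0 where w0: "w0 \<in> A" "\<And>w. w \<in> A \<Longrightarrow> g w \<le> g w0"
        using continuous_attains_sup[OF \<open>compact A\<close> False cg] by blast
      have "g w0 < 0" unfolding g_def by (rule neg[OF i]) (use w0(1) in \<open>auto simp: A_def\<close>)
      then show ?thesis using w0 that[of "- g w0"] by auto
    qed (use that[of 1] in auto)
    have "g w \<le> - c * (norm w)\<^sup>2" if w: "\<pi> w = w" for w
    proof (cases "w = 0")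
      case False
      define u where "u = w /\<^sub>R norm w"
      have "u \<in> A" using False w by (simp add: A_def u_def linear_cmul[OF \<pi>])
      then have "g u \<le> - c" by (rule c(2))
      moreover have "g w = (norm w)\<^sup>2 * g u"
      proof -
        have "w = norm w *\<^sub>R u" using False by (simp add: u_def)
        then have "g w = g (norm w *\<^sub>R u)" by simp
        then show ?thesis
          by (simp add: g_def linear_cmul[OF bounded_linear.linear[OF G]] blinfun.scaleR_right power2_eq_square)
      qed
      ultimately show ?thesis using mult_left_mono[of "g u" "- c" "(norm w)\<^sup>2"] by (simp add: mult.commute)
    qed (simp add: g_def blinfun.zero_right)
    then show ?thesis using c(1) unfolding g_def by blast
  qed
  then obtain c where c: "\<And>i. i \<in> I \<Longrightarrow> c i > 0"
    "\<And>i w. i \<in> I \<Longrightarrow> \<pi> w = w \<Longrightarrow> inner (G w) (blinfun_apply (\<Lambda> i) w) \<le> - c i * (norm w)\<^sup>2" by metis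
  \<comment> \<open>The inserted 1 keeps the minimum defined for empty \<open>I\<close>.\<close>
  define m where "m = Min (insert 1 (c ` I))"
  have "m > 0" unfolding m_def using fin c(1) by (subst Min_gr_iff) auto
  moreover have "inner (G w) (blinfun_apply (\<Lambda> i) w) \<le> - m * (norm w)\<^sup>2" if "i \<in> I" "\<pi> w = w" for i w
  proof -
    have "m \<le> c i" unfolding m_def using fin that by (intro Min_le) auto
    then have "m * (norm w)\<^sup>2 \<le> c i * (norm w)\<^sup>2" by (intro mult_right_mono) auto
    then show ?thesis using c(2)[OF that] by simp
  qed
  ultimately show ?thesis by blast
qed

text \<open>The displacement \<open>d\<close> to a nearest point splits as \<open>e + k\<close> with
  \<open>e\<close> in the common kernel and \<open>k\<close> in the range of \<open>\<pi>\<close>.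
  Nearness makes \<open>d\<close> orthogonal to the tangent space in the inner product of
  \<open>G\<close>, and the tangent space is close to the kernel, so \<open>e\<close> is small.
  Dissipation in \<open>k\<close> then dominates all errors.\<close>

lemma (in energy_form) manifold_lyapunov_step:
  fixes f \<pi> :: "'a \<Rightarrow> 'a" and \<Lambda> :: "nat \<Rightarrow> 'a \<Rightarrow>\<^sub>L 'a"
  assumes \<pi>: "linear \<pi>" "\<And>v. \<pi> (\<pi> v) = \<pi> v" "\<And>e v. \<pi> e = 0 \<Longrightarrow> inner (G e) (\<pi> v) = 0"
    and S: "submanifold_dim p S" "dim {v. \<pi> v = 0} = p" "s \<in> S" and eq: "\<And>x. x \<in> S \<Longrightarrow> f x = 0"
    and fin: "finite I" and ker: "\<And>i e. i \<in> I \<Longrightarrow> \<pi> e = 0 \<Longrightarrow> blinfun_apply (\<Lambda> i) e = 0"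
    and neg: "\<And>i w. i \<in> I \<Longrightarrow> \<pi> w = w \<Longrightarrow> w \<noteq> 0 \<Longrightarrow> inner (G w) (blinfun_apply (\<Lambda> i) w) < 0"
    and incr: "\<And>\<epsilon>. \<epsilon> > 0 \<Longrightarrow> \<exists>\<delta>>0. \<forall>x\<in>ball s \<delta>. \<forall>y\<in>ball s \<delta>. \<forall>l. \<exists>i\<in>I.
      inner l (f x - f y) \<le> inner l (blinfun_apply (\<Lambda> i) (x - y)) + \<epsilon> * norm l * norm (x - y)"
  obtains K c L r where "compact K" "s \<in> K" "K \<subseteq> S" "c > 0" "L > 0" "r > 0"
    "L-lipschitz_on (ball s r) f"
    "\<And>x. x \<in> ball s r \<Longrightarrow> \<exists>s'\<in>K. (\<forall>s''\<in>K. energy G (x - s') \<le> energy G (x - s'')) \<and>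
        inner (G (x - s')) (f x) \<le> - c * (norm (x - s'))\<^sup>2 \<and> norm (f x) \<le> L * norm (x - s')"
proof -
  note Gadd = linear_add[OF bounded_linear.linear[OF lin]]
  have "\<exists>c>0. \<forall>i\<in>I. \<forall>w. \<pi> w = w \<longrightarrow> inner (G w) (blinfun_apply (\<Lambda> i) w) \<le> - c * (norm w)\<^sup>2"
    by (rule negative_form_bound[OF lin \<pi>(1) fin]) (rule neg)
  then obtain c1 where c1: "c1 > 0" "\<And>i w. i \<in> I \<Longrightarrow> \<pi> w = w \<Longrightarrow>
      inner (G w) (blinfun_apply (\<Lambda> i) w) \<le> - c1 * (norm w)\<^sup>2"
    by blast
  obtain C1 where C1: "C1 > 0" "\<And>x. norm (\<pi> x) \<le> C1 * norm x" using linear_bounded_pos[OF \<pi>(1)] by blast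
  define C2 where "C2 = 1 + (\<Sum>i\<in>I. norm (\<Lambda> i))"
  have C2: "C2 > 0" by (simp add: C2_def add_pos_nonneg sum_nonneg)
  have \<Lambda>: "norm (blinfun_apply (\<Lambda> i) v) \<le> C2 * norm v" if "i \<in> I" for i v
  proof -
    have "norm (\<Lambda> i) \<le> C2" unfolding C2_def using member_le_sum[of i I "\<lambda>i. norm (\<Lambda> i)"] fin that by simp
    then show ?thesis by (rule order_trans[OF norm_blinfun mult_right_mono]) simp
  qed
  have split: "\<pi> (d - \<pi> d) = 0" for d by (simp add: linear_diff[OF \<pi>(1)] \<pi>(2))
  have \<Lambda>\<pi>: "blinfun_apply (\<Lambda> i) d = blinfun_apply (\<Lambda> i) (\<pi> d)" if "i \<in> I" for i d
    using ker[OF that split[of d]] by (simp add: blinfun.diff_right)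
  \<comment> \<open>Chosen so that \<open>norm e \<le> a * \<epsilon> * norm d\<close> below; the
    factor \<open>C0 / c1\<close> comes from the cone opening \<open>\<eta>\<close>.\<close>
  define a where "a = 2 * C0 / c0 * (C0 / c1)"
  have a: "a > 0" using C0 c0 c1 by (simp add: a_def)
  \<comment> \<open>Total error per \<open>\<epsilon>\<close>: the cross term between
    \<open>e\<close> and \<open>k\<close>, and the increment error.\<close>
  define m where "m = C0 * C2 * C1 * a + C0"
  have m: "m > 0" using C0 C1 C2 a by (simp add: m_def add_pos_pos)
  \<comment> \<open>The three bounds give, in this order, \<open>\<eta> \<le> 1 / 2\<close>,
    \<open>a * \<epsilon> \<le> 1 / 2\<close> and
    \<open>m * \<epsilon> \<le> c1 / 8\<close>.\<close>
  define \<epsilon> where "\<epsilon> = min (1 / (2 * (C0 / c1))) (min (1 / (2 * a)) (c1 / (8 * m)))"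
  have \<epsilon>: "\<epsilon> > 0" using C0 c1 a m by (simp add: \<epsilon>_def)
  define \<eta> where "\<eta> = C0 / c1 * \<epsilon>"
  have "\<epsilon> \<le> 1 / (2 * (C0 / c1))" "\<epsilon> \<le> 1 / (2 * a)" "\<epsilon> \<le> c1 / (8 * m)" by (auto simp: \<epsilon>_def)
  then have \<eta>: "0 \<le> \<eta>" "\<eta> \<le> 1 / 2" and a\<epsilon>: "a * \<epsilon> \<le> 1 / 2" and m\<epsilon>: "m * \<epsilon> \<le> c1 / 8"
    using C0 c1(1) a m \<epsilon> by (simp_all add: \<eta>_def field_simps)
  have a\<eta>: "2 * C0 / c0 * \<eta> = a * \<epsilon>" by (simp add: a_def \<eta>_def)
  obtain \<delta> where \<delta>: "\<delta> > 0" "\<And>x y l. x \<in> ball s \<delta> \<Longrightarrow> y \<in> ball s \<delta> \<Longrightarrow> \<exists>i\<in>I.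
      inner l (f x - f y) \<le> inner l (blinfun_apply (\<Lambda> i) (x - y)) + \<epsilon> * norm l * norm (x - y)"
    using incr[OF \<epsilon>] by blast
  define L where "L = C2 + \<epsilon>"
  have L: "L > 0" using C2 \<epsilon> by (simp add: L_def)
  have lip: "norm (f x - f y) \<le> L * norm (x - y)" if xy: "x \<in> ball s \<delta>" "y \<in> ball s \<delta>" for x y
  proof -
    let ?l = "f x - f y"
    \<comment> \<open>Testing the increment against itself yields the Lipschitz bound.\<close>
    obtain i where i: "i \<in> I" "inner ?l ?l \<le> inner ?l (blinfun_apply (\<Lambda> i) (x - y)) + \<epsilon> * norm ?l * norm (x - y)"
      using \<delta>(2)[OF xy] by blast
    have "inner ?l (blinfun_apply (\<Lambda> i) (x - y)) \<le> norm ?l * (C2 * norm (x - y))"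
      by (rule order_trans[OF norm_cauchy_schwarz mult_left_mono[OF \<Lambda>[OF i(1)]]]) simp
    with i(2) have "norm ?l * norm ?l \<le> norm ?l * (L * norm (x - y))"
      by (simp add: L_def dot_square_norm power2_eq_square algebra_simps)
    then show ?thesis using L by (cases "?l = 0") auto
  qed
  \<comment> \<open>Both points are zeros of \<open>f\<close>, so the dissipation in the direction \<open>\<pi> (x - y)\<close> can only be compensated
    by the error term.\<close>
  have cone: "norm (\<pi> (x - y)) \<le> \<eta> * norm (x - y)" if xy: "x \<in> ball s \<delta>" "y \<in> ball s \<delta>" "x \<in> S" "y \<in> S" for x y
  proof (cases "\<pi> (x - y) = 0")
    case False
    let ?k = "\<pi> (x - y)"
    obtain i where i: "i \<in> I" "inner (G ?k) (f x - f y) \<le>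
        inner (G ?k) (blinfun_apply (\<Lambda> i) (x - y)) + \<epsilon> * norm (G ?k) * norm (x - y)"
      using \<delta>(2)[OF xy(1,2)] by blast
    have "inner (G ?k) (blinfun_apply (\<Lambda> i) (x - y)) \<le> - c1 * (norm ?k)\<^sup>2"
      using c1(2)[OF i(1), of ?k] by (simp add: \<pi>(2) \<Lambda>\<pi>[OF i(1), of "x - y"])
    moreover have "\<epsilon> * norm (G ?k) * norm (x - y) \<le> \<epsilon> * (C0 * norm ?k) * norm (x - y)"
      using \<epsilon> by (intro mult_right_mono mult_left_mono upper) auto
    ultimately have "norm ?k * (c1 * norm ?k) \<le> norm ?k * (C0 * \<epsilon> * norm (x - y))"
      using i(2) eq xy by (simp add: power2_eq_square mult_ac)
    then have "c1 * norm ?k \<le> C0 * \<epsilon> * norm (x - y)" using False by simp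
    then show ?thesis using c1(1) by (simp add: \<eta>_def field_simps)
  qed (use \<eta> in simp)
  obtain r0 where r0: "r0 > 0" "\<And>r'. r' \<le> r0 \<Longrightarrow> compact (S \<inter> cball s r')"
    using submanifold_locally_compact[OF S(1,3)] by blast
  define r where "r = min r0 (\<delta> / 2)"
  have r: "r > 0" "cball s r \<subseteq> ball s \<delta>" using r0 \<delta>(1) by (auto simp: r_def)
  define K where "K = S \<inter> cball s r"
  have K: "compact K" "s \<in> K" "K \<subseteq> S" using r0(2)[of r] r S(3) by (auto simp: K_def r_def)
  \<comment> \<open>The distortion between the two norms: a nearest point for \<open>G\<close> is at
    Euclidean distance at most \<open>q * norm (x - s)\<close>.\<close>
  define q where "q = sqrt (C0 / c0)"
  have q: "q \<ge> 0" "q\<^sup>2 = C0 / c0" using C0 c0 by (simp_all add: q_def)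
  \<comment> \<open>For \<open>x\<close> this close to \<open>s\<close> the minimizer lies in the
    open ball of radius \<open>r\<close>, so nearby points of \<open>S\<close> belong to
    \<open>K\<close> and minimality can be tested along curves in \<open>S\<close>.\<close>
  define \<rho> where "\<rho> = r / (2 * (1 + q))"
  have \<rho>: "\<rho> > 0" "\<rho> \<le> r" "(1 + q) * \<rho> < r" using r(1) q(1) by (simp_all add: \<rho>_def field_simps add_pos_nonneg)
  \<comment> \<open>\<open>c1 / 4\<close> remains since \<open>norm k\<close> is at least half of
    \<open>norm d\<close>, and the errors use up \<open>c1 / 8\<close>.\<close>
  define c where "c = c1 / 8"
  have c: "c > 0" using c1 by (simp add: c_def)
  have step: "\<exists>s'\<in>K. (\<forall>s''\<in>K. energy G (x - s') \<le> energy G (x - s'')) \<and>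
        inner (G (x - s')) (f x) \<le> - c * (norm (x - s'))\<^sup>2 \<and> norm (f x) \<le> L * norm (x - s')"
    if x: "x \<in> ball s \<rho>" for x
  proof -
    have "continuous_on K (\<lambda>y. energy G (x - y))"
      unfolding energy_def by (intro continuous_intros bounded_linear.continuous_on[OF lin])
    then obtain s' where s': "s' \<in> K" "\<And>y. y \<in> K \<Longrightarrow> energy G (x - s') \<le> energy G (x - y)"
      using continuous_attains_inf[OF K(1)] K(2) by (metis empty_iff)
    define d where "d = x - s'"
    have "c0 * (norm d)\<^sup>2 \<le> C0 * (norm (x - s))\<^sup>2"
      unfolding d_def by (rule order_trans[OF lower order_trans[OF s'(2)[OF K(2)] energy_upper]])
    then have "(norm d)\<^sup>2 \<le> (q * norm (x - s))\<^sup>2" using c0 by (simp add: power_mult_distrib q(2) field_simps)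
    then have dq: "norm d \<le> q * norm (x - s)" by (rule power2_le_imp_le) (use q in auto)
    have "dist s s' \<le> norm (x - s) + norm d"
      unfolding d_def using dist_triangle[of s s' x] by (simp add: dist_norm norm_minus_commute)
    also have "\<dots> \<le> (1 + q) * norm (x - s)" using dq by (simp add: algebra_simps)
    also have "\<dots> \<le> (1 + q) * \<rho>" using x q by (intro mult_left_mono) (auto simp: dist_norm norm_minus_commute)
    finally have s'r: "s' \<in> ball s r" using \<rho>(3) by simp
    have "x \<in> cball s r" "s' \<in> cball s r" using x \<rho>(2) s'(1) by (auto simp: K_def)
    then have in\<delta>: "x \<in> ball s \<delta>" "s' \<in> ball s \<delta>" using r(2) by blast+
    have s'S: "s' \<in> S" using s'(1) by (simp add: K_def)
    obtain Tn where Tn: "subspace Tn" "dim Tn = p"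
      "\<And>v. v \<in> Tn \<Longrightarrow> \<exists>c::real \<Rightarrow> 'a. c 0 = s' \<and> (c has_vector_derivative v) (at 0) \<and> (\<forall>\<^sub>F t in nhds 0. c t \<in> S)"
      using submanifold_tangent_space[OF S(1) s'S] by blast
    have tangent: "norm (\<pi> v) \<le> \<eta> * norm v \<and> inner (G d) v = 0" if v: "v \<in> Tn" for v
    proof -
      obtain \<gamma> where \<gamma>: "\<gamma> 0 = s'" "(\<gamma> has_vector_derivative v) (at 0)" "\<forall>\<^sub>F t in nhds 0. \<gamma> t \<in> S"
        using Tn(3)[OF v] by blast
      have "isCont \<gamma> 0" using \<gamma>(2) by (rule has_vector_derivative_continuous)
      then have "(\<gamma> \<longlongrightarrow> s') (nhds 0)" using tendsto_at_iff_tendsto_nhds[of \<gamma> 0] \<gamma>(1) by (simp add: isCont_def)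
      then have "\<forall>\<^sub>F t in nhds 0. \<gamma> t \<in> ball s r" using open_ball s'r by (rule topological_tendstoD)
      with \<gamma>(3) have \<gamma>K: "\<forall>\<^sub>F t in nhds 0. \<gamma> t \<in> K" by eventually_elim (auto simp: K_def)
      have "norm (\<pi> v) \<le> \<eta> * norm v"
      proof (rule tangent_in_cone[OF \<gamma>(2) \<pi>(1) _ \<eta>(1)])
        show "\<forall>\<^sub>F t in nhds 0. norm (\<pi> (\<gamma> t - \<gamma> 0)) \<le> \<eta> * norm (\<gamma> t - \<gamma> 0)"
          using \<gamma>K by eventually_elim (use r(2) in\<delta> s'S in \<open>auto simp: \<gamma>(1) K_def intro!: cone\<close>)
      qed
      moreover have "inner (G (x - \<gamma> 0)) v = 0"
        by (rule minimizer_orthogonal_tangent[OF \<gamma>(2)])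
          (use \<gamma>K in eventually_elim, simp add: \<gamma>(1) s'(2))
      ultimately show ?thesis by (simp add: \<gamma>(1) d_def)
    qed
    define e where "e = d - \<pi> d"
    have \<pi>e: "\<pi> e = 0" unfolding e_def by (rule split)
    have e: "norm e \<le> a * \<epsilon> * norm d"
    proof (cases "e = 0")
      case False
      obtain v where v: "v \<in> Tn" "norm (e - v) \<le> 2 * \<eta> * norm e"
        using graph_over_kernel[OF \<pi>(1,2) Tn(1) _ _ \<eta> \<pi>e] tangent Tn(2) S(2) by metis
      \<comment> \<open>The kernel and the range of \<open>\<pi>\<close> are orthogonal for
        \<open>G\<close>, so \<open>e\<close> may be paired with all of \<open>d\<close>; then a
        tangent vector near \<open>e\<close> can be subtracted for free.\<close>
      have "c0 * (norm e)\<^sup>2 \<le> inner (G e) e" using lower[of e] by (simp add: energy_def)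
      also have "\<dots> = inner (G e) (e + \<pi> d)" using \<pi>(3)[OF \<pi>e] by (simp add: inner_add_right)
      also have "\<dots> = inner (G d) e" using sym[of e d] by (simp add: e_def inner_commute)
      also have "\<dots> = inner (G d) (e - v)" using tangent[OF v(1)] by (simp add: inner_diff_right)
      also have "\<dots> \<le> norm (G d) * norm (e - v)" by (rule norm_cauchy_schwarz)
      also have "\<dots> \<le> (C0 * norm d) * (2 * \<eta> * norm e)" using C0 by (intro mult_mono upper v(2)) auto
      finally have "norm e * (c0 * norm e) \<le> norm e * (2 * C0 * \<eta> * norm d)"
        by (simp add: power2_eq_square mult_ac)
      then have "c0 * norm e \<le> 2 * C0 * \<eta> * norm d" using False by simp
      then have "norm e \<le> 2 * C0 / c0 * \<eta> * norm d" using c0 by (simp add: field_simps)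
      then show ?thesis by (simp only: a\<eta>)
    qed (use a \<epsilon> in simp)
    define k where "k = \<pi> d"
    have dek: "d = e + k" by (simp add: e_def k_def)
    have \<pi>k: "\<pi> k = k" by (simp add: k_def \<pi>(2))
    have "norm e \<le> 1 / 2 * norm d" by (rule order_trans[OF e mult_right_mono[OF a\<epsilon>]]) simp
    then have "norm d \<le> 2 * norm k" using norm_triangle_ineq[of e k] dek by simp
    then have "(norm d)\<^sup>2 \<le> (2 * norm k)\<^sup>2" by (intro power_mono) auto
    then have kd: "(norm d)\<^sup>2 / 4 \<le> (norm k)\<^sup>2" by (simp add: power_mult_distrib)
    obtain i where i: "i \<in> I" "inner (G d) (f x - f s') \<le> inner (G d) (blinfun_apply (\<Lambda> i) d) + \<epsilon> * norm (G d) * norm d"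
      using \<delta>(2)[OF in\<delta>, of "G d"] unfolding d_def by blast
    have "inner (G d) (blinfun_apply (\<Lambda> i) d) = inner (G k) (blinfun_apply (\<Lambda> i) k) + inner (G e) (blinfun_apply (\<Lambda> i) k)"
      using \<Lambda>\<pi>[OF i(1), of d] Gadd[of e k] by (simp add: inner_add_left flip: dek k_def)
    also have "inner (G k) (blinfun_apply (\<Lambda> i) k) \<le> - c1 * (norm k)\<^sup>2" by (rule c1(2)[OF i(1) \<pi>k])
    also have "- c1 * (norm k)\<^sup>2 \<le> - c1 * ((norm d)\<^sup>2 / 4)" using kd c1(1) by simp
    also have "inner (G e) (blinfun_apply (\<Lambda> i) k) \<le> (C0 * (a * \<epsilon> * norm d)) * (C2 * (C1 * norm d))"
    proof -
      have "norm (G e) \<le> C0 * (a * \<epsilon> * norm d)"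
        using C0 by (intro order_trans[OF upper mult_left_mono[OF e]]) auto
      moreover have "norm (blinfun_apply (\<Lambda> i) k) \<le> C2 * (C1 * norm d)"
        unfolding k_def using C2 by (intro order_trans[OF \<Lambda>[OF i(1)] mult_left_mono[OF C1(2)]]) auto
      ultimately have "norm (G e) * norm (blinfun_apply (\<Lambda> i) k) \<le> (C0 * (a * \<epsilon> * norm d)) * (C2 * (C1 * norm d))"
        using C0 a \<epsilon> by (intro mult_mono) auto
      then show ?thesis by (rule order_trans[OF norm_cauchy_schwarz])
    qed
    finally have main: "inner (G d) (blinfun_apply (\<Lambda> i) d) \<le> - c1 * ((norm d)\<^sup>2 / 4) + (C0 * (a * \<epsilon> * norm d)) * (C2 * (C1 * norm d))"
      by simp
    have "\<epsilon> * norm (G d) * norm d \<le> \<epsilon> * (C0 * norm d) * norm d"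
      using \<epsilon> by (intro mult_right_mono mult_left_mono upper) auto
    then have "inner (G d) (f x) \<le> - c1 * ((norm d)\<^sup>2 / 4) + m * \<epsilon> * (norm d)\<^sup>2"
      using i(2) main eq[OF s'S] by (simp add: m_def power2_eq_square algebra_simps)
    also have "m * \<epsilon> * (norm d)\<^sup>2 \<le> c1 / 8 * (norm d)\<^sup>2" using m\<epsilon> by (intro mult_right_mono) auto
    finally have "inner (G d) (f x) \<le> - c * (norm d)\<^sup>2" by (simp add: c_def)
    moreover have "norm (f x) \<le> L * norm d" using lip[OF in\<delta>] eq[OF s'S] by (simp add: d_def)
    ultimately show ?thesis using s' by (auto simp: d_def)
  qed
  have "L-lipschitz_on (ball s \<rho>) f"
  proof (rule lipschitz_onI)
    fix x y assume "x \<in> ball s \<rho>" "y \<in> ball s \<rho>"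
    then have "x \<in> cball s r" "y \<in> cball s r" using \<rho>(2) by auto
    then have "x \<in> ball s \<delta>" "y \<in> ball s \<delta>" using r(2) by blast+
    then show "dist (f x) (f y) \<le> L * dist x y" using lip by (simp add: dist_norm)
  qed (use L in simp)
  from that[OF K c L \<rho>(1) this step] show ?thesis .
qed

section \<open>Saddle points\<close>

text \<open>An interior extremum makes the derivative vanish; as \<open>grad\<close> is a definite
  description, uniqueness of the gradient has to be shown as well.\<close>

lemma grad_eq_0_of_local_extremum:
  fixes g :: "'a::real_inner \<Rightarrow> real"
  assumes "(g has_derivative g') (at x)" and "open U" "x \<in> U"
    and "(\<forall>y\<in>U. g x \<le> g y) \<or> (\<forall>y\<in>U. g y \<le> g x)"
  shows "grad g x = 0"
proof -
  have "g' = (\<lambda>h. 0)"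
    using assms(4)
  proof
    assume "\<forall>y\<in>U. g x \<le> g y"
    then show ?thesis
      by (intro has_derivative_local_min[OF assms(1)]) (use assms(2,3) in \<open>auto simp: eventually_at_topological\<close>)
  next
    assume *: "\<forall>y\<in>U. g y \<le> g x"
    have "(\<lambda>h. - g' h) = (\<lambda>h. 0)"
      by (rule has_derivative_local_min[OF has_derivative_minus[OF assms(1)]])
        (use * assms(2,3) in \<open>auto simp: eventually_at_topological\<close>)
    then show ?thesis by (metis neg_equal_0_iff_equal)
  qed
  then have "GDERIV g x :> 0" using assms(1) by (simp add: gderiv_def)
  moreover have "D = 0" if "GDERIV g x :> D" for D
  proof -
    have "(\<lambda>h. inner h D) = (\<lambda>h. inner h 0)"
      using that \<open>GDERIV g x :> 0\<close> unfolding gderiv_def by (rule has_derivative_unique)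
    then show ?thesis by (metis inner_eq_zero_iff inner_zero_right)
  qed
  ultimately show ?thesis unfolding grad_def by (rule the_equality)
qed

lemma Xsp_eq_0_of_Saddle:
  fixes F :: "('a::real_inner) \<times> ('b::real_inner) \<Rightarrow> real"
  assumes "C1_on F UNIV" "s \<in> Saddle F"
  shows "Xsp F s = 0"
proof -
  obtain x z where s: "s = (x, z)" by (cases s)
  obtain U V where U: "open U" "x \<in> U" and V: "open V" "z \<in> V"
    and *: "\<And>x' z'. x' \<in> U \<Longrightarrow> z' \<in> V \<Longrightarrow> F (x, z') \<le> F (x, z) \<and> F (x, z) \<le> F (x', z)"
    using assms(2) unfolding Saddle_def s by blast
  obtain F' where F': "(F has_derivative F') (at (x, z))" using assms(1) unfolding C1_on_def by blast
  have "((\<lambda>x'. (x', z)) has_derivative (\<lambda>h. (h, 0))) (at x)" by (auto intro!: derivative_eq_intros)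
  from has_derivative_compose[OF this F']
  have "((\<lambda>x'. F (x', z)) has_derivative (\<lambda>h. F' (h, 0))) (at x)" .
  then have 1: "grad (\<lambda>x'. F (x', z)) x = 0"
    by (rule grad_eq_0_of_local_extremum[OF _ U]) (use * V in blast)
  have "((\<lambda>z'. (x, z')) has_derivative (\<lambda>h. (0, h))) (at z)" by (auto intro!: derivative_eq_intros)
  from has_derivative_compose[OF this F']
  have "((\<lambda>z'. F (x, z')) has_derivative (\<lambda>h. F' (0, h))) (at z)" .
  then have 2: "grad (\<lambda>z'. F (x, z')) z = 0"
    by (rule grad_eq_0_of_local_extremum[OF _ V]) (use * U in blast)
  show ?thesis by (simp add: Xsp_def s 1 2 zero_prod_def)
qed

text \<open>Assembly at a single point \<open>s\<close>: the matrices become operators, these give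
  the dissipation inequality near \<open>s\<close>, and it controls the trajectories.\<close>

lemma equilibrium_manifold_convergence:
  fixes f :: "'a::euclidean_space \<Rightarrow> 'a"
  assumes pC2: "piecewise_C2 f" and subm: "submanifold_dim p S" and eq: "\<And>x. x \<in> S \<Longrightarrow> f x = 0"
    and s: "s \<in> S" and q: "q = DIM('a) - p"
    and Q: "orthonormal_mat DIM('a) Q" and P: "pos_def_mat q P"
    and block: "\<And>A. A \<in> Jacobian_limits f s \<Longrightarrow> \<exists>B \<in> carrier_mat q q.
      transpose_mat Q * A * Q = zero_block p q B \<and> neg_def_mat q (transpose_mat B * P + P * B)"
    and \<epsilon>: "\<epsilon> > 0"
  shows "\<exists>\<delta>>0. \<forall>T y. trajectory f T y \<and> y 0 \<in> ball s \<delta> \<longrightarrow>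
    T = \<infinity> \<and> (\<forall>t\<ge>0. dist (y t) s < \<epsilon>) \<and> (\<exists>x\<in>S. (y \<longlongrightarrow> x) at_top)"
proof -
  \<comment> \<open>Keeps the subtraction defining \<open>q\<close> from being truncated.\<close>
  have p: "p \<le> DIM('a)"
    using subm s unfolding submanifold_dim_def by (metis dim_subset_UNIV)
  obtain G \<pi> :: "'a \<Rightarrow> 'a" where
    G: "linear G" "\<And>v w. inner (G v) w = inner v (G w)" "\<And>v. v \<noteq> 0 \<Longrightarrow> inner (G v) v > 0" and
    \<pi>: "linear \<pi>" "\<And>v. \<pi> (\<pi> v) = \<pi> v" "dim {v. \<pi> v = 0} = p" "\<And>e v. \<pi> e = 0 \<Longrightarrow> inner (G e) (\<pi> v) = 0" and
    lyap: "\<And>\<Lambda> B. linear \<Lambda> \<Longrightarrow> B \<in> carrier_mat q q \<Longrightarrow>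
      transpose_mat Q * Matrix.mat DIM('a) DIM('a)
        (\<lambda>(i, j). inner (from_nat_into Basis i) (\<Lambda> (from_nat_into Basis j))) * Q = zero_block p q B \<Longrightarrow>
      neg_def_mat q (transpose_mat B * P + P * B) \<Longrightarrow>
      (\<forall>e. \<pi> e = 0 \<longrightarrow> \<Lambda> e = 0) \<and> (\<forall>w. \<pi> w = w \<longrightarrow> w \<noteq> 0 \<longrightarrow> inner (G w) (\<Lambda> w) < 0)"
    by (rule lyapunov_operators[OF p q Q P]) blast
  obtain I :: "nat set" and \<Lambda> :: "nat \<Rightarrow> 'a \<Rightarrow>\<^sub>L 'a" where fin: "finite I" and
    lim: "\<And>i. i \<in> I \<Longrightarrow> Matrix.mat DIM('a) DIM('a)
      (\<lambda>(j, k). inner (from_nat_into Basis j) (blinfun_apply (\<Lambda> i) (from_nat_into Basis k))) \<in> Jacobian_limits f s" and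
    incr: "\<And>\<epsilon>. \<epsilon> > 0 \<Longrightarrow> \<exists>\<delta>>0. \<forall>x\<in>ball s \<delta>. \<forall>y\<in>ball s \<delta>. \<forall>l. \<exists>i\<in>I.
      inner l (f x - f y) \<le> inner l (blinfun_apply (\<Lambda> i) (x - y)) + \<epsilon> * norm l * norm (x - y)"
    by (rule piecewise_C2_increment_bound[OF pC2, of s]) blast
  have \<Lambda>: "(\<forall>e. \<pi> e = 0 \<longrightarrow> blinfun_apply (\<Lambda> i) e = 0) \<and>
      (\<forall>w. \<pi> w = w \<longrightarrow> w \<noteq> 0 \<longrightarrow> inner (G w) (blinfun_apply (\<Lambda> i) w) < 0)" if "i \<in> I" for i
    using block[OF lim[OF that]] lyap[OF bounded_linear.linear[OF blinfun.bounded_linear_right]] by blast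
  have bG: "bounded_linear G" using G(1) by (rule linear_conv_bounded_linear[THEN iffD1])
  \<comment> \<open>Coercivity of \<open>G\<close> is the compactness bound for the single operator
    \<open>- id_blinfun\<close> with the identity as projection.\<close>
  have "\<exists>c>0. \<forall>i\<in>{0::nat}. \<forall>w. w = w \<longrightarrow> inner (G w) (blinfun_apply (- id_blinfun) w) \<le> - c * (norm w)\<^sup>2"
    by (rule negative_form_bound[OF bG linear_ident]) (use G(3) in \<open>auto simp: blinfun.minus_left\<close>)
  then obtain c0 where c0: "c0 > 0" "\<And>w. c0 * (norm w)\<^sup>2 \<le> inner (G w) w"
    by (auto simp: blinfun.minus_left)
  obtain C0 where C0: "C0 > 0" "\<And>v. norm (G v) \<le> C0 * norm v" using linear_bounded_pos[OF G(1)] by blast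
  interpret energy_form G c0 C0
    by (rule energy_form.intro[OF bG G(2) c0(1) _ C0]) (simp add: energy_def c0(2))
  obtain K c L r where K: "compact K" "s \<in> K" "K \<subseteq> S" "c > 0" "L > 0" "r > 0"
    "L-lipschitz_on (ball s r) f"
    "\<And>x. x \<in> ball s r \<Longrightarrow> \<exists>s'\<in>K. (\<forall>s''\<in>K. energy G (x - s') \<le> energy G (x - s'')) \<and>
        inner (G (x - s')) (f x) \<le> - c * (norm (x - s'))\<^sup>2 \<and> norm (f x) \<le> L * norm (x - s')"
    by (rule manifold_lyapunov_step[OF \<pi>(1,2,4) subm \<pi>(3) s eq fin _ _ incr]) (use \<Lambda> in blast)+
  have "continuous_on UNIV f" using pC2 by (simp add: piecewise_C2_def)
  from trajectory_converges[OF K(1,2,4-6) \<epsilon> this K(7,8)] K(3) show ?thesis by blast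
qed

theorem proposition5p1:
  fixes F :: "(real^'n) \<times> (real^'m) \<Rightarrow> real"
    and S :: "((real^'n) \<times> (real^'m)) set"
    and p q :: nat
  assumes C1: "C1_on F UNIV"
    and saddle: "S \<subseteq> Saddle F"
    and subm: "submanifold_dim p S"
    and lip: "\<exists>U. open U \<and> S \<subseteq> U \<and> C1_on F U \<and>
                local_lipschitz (UNIV :: real set) U (\<lambda>_. grad F)"
    and pC2: "piecewise_C2 (Xsp F)"
    and q: "q = CARD('n) + CARD('m) - p"
    and i_iii: "\<And>s. s \<in> S \<Longrightarrow>
        \<exists>Q. orthonormal_mat (CARD('n) + CARD('m)) Q \<and>
            (\<forall>A \<in> Jacobian_limits (Xsp F) s.
               \<exists>B \<in> carrier_mat q q. transpose_mat Q * A * Q = zero_block p q B) \<and>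
            (\<exists>P. pos_def_mat q P \<and>
               (\<forall>A \<in> Jacobian_limits (Xsp F) s. \<forall>B \<in> carrier_mat q q.
                  transpose_mat Q * A * Q = zero_block p q B \<longrightarrow>
                  neg_def_mat q (transpose_mat B * P + P * B)))"
    and ii: "\<And>s A l. s \<in> S \<Longrightarrow> A \<in> Jacobian_limits (Xsp F) s \<Longrightarrow>
        eigenvalue (map_mat complex_of_real A) l \<Longrightarrow> l \<noteq> 0 \<Longrightarrow> Re l < 0"
  shows "locally_asymptotically_stable (Xsp F) S \<and> trajectories_converge_to_point_in (Xsp F) S"
proof -
  have eq: "Xsp F s = 0" if "s \<in> S" for s using Xsp_eq_0_of_Saddle[OF C1] saddle that by blast
  have dim: "DIM((real^'n) \<times> (real^'m)) = CARD('n) + CARD('m)" by simp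
  have loc: "\<exists>\<delta>>0. \<forall>T y. trajectory (Xsp F) T y \<and> y 0 \<in> ball s \<delta> \<longrightarrow>
      T = \<infinity> \<and> (\<forall>t\<ge>0. dist (y t) s < \<epsilon>) \<and> (\<exists>x\<in>S. (y \<longlongrightarrow> x) at_top)"
    if s: "s \<in> S" and \<epsilon>: "\<epsilon> > 0" for s \<epsilon>
  proof -
    obtain Q P where Q: "orthonormal_mat (CARD('n) + CARD('m)) Q" and P: "pos_def_mat q P"
      and B: "\<And>A. A \<in> Jacobian_limits (Xsp F) s \<Longrightarrow> \<exists>B \<in> carrier_mat q q.
        transpose_mat Q * A * Q = zero_block p q B \<and> neg_def_mat q (transpose_mat B * P + P * B)"
      using i_iii[OF s] by blast
    show ?thesis
      by (rule equilibrium_manifold_convergence[OF pC2 subm eq s _ _ P B \<epsilon>]) (use q Q dim in simp_all)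
  qed
  have nbhd: "\<exists>W. open W \<and> S \<subseteq> W \<and> (\<forall>T y. trajectory (Xsp F) T y \<and> y 0 \<in> W \<longrightarrow>
      T = \<infinity> \<and> (\<exists>s\<in>S. \<forall>t\<ge>0. dist (y t) s < \<epsilon>) \<and> (\<exists>x\<in>S. (y \<longlongrightarrow> x) at_top))"
    if \<epsilon>: "\<epsilon> > 0" for \<epsilon>
  proof -
    \<comment> \<open>The radius depends on \<open>s\<close>, and \<open>S\<close> need not be
      compact; a union of balls serves as the neighbourhood.\<close>
    obtain \<delta> where \<delta>: "\<And>s. s \<in> S \<Longrightarrow> \<delta> s > 0" "\<And>s T y. s \<in> S \<Longrightarrow> trajectory (Xsp F) T y \<Longrightarrow> y 0 \<in> ball s (\<delta> s) \<Longrightarrow>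
      T = \<infinity> \<and> (\<forall>t\<ge>0. dist (y t) s < \<epsilon>) \<and> (\<exists>x\<in>S. (y \<longlongrightarrow> x) at_top)"
      using loc[OF _ \<epsilon>] by metis
    have "S \<subseteq> (\<Union>s\<in>S. ball s (\<delta> s))" using \<delta>(1) by force
    then show ?thesis
      using \<delta>(2) by (intro exI[of _ "\<Union>s\<in>S. ball s (\<delta> s)"]) blast
  qed
  have near: "infdist x S < \<epsilon>" if "s \<in> S" "dist x s < \<epsilon>" for x s \<epsilon>
    using infdist_le[OF that(1), of x] that(2) by simp
  have conv: "((\<lambda>t. infdist (y t) S) \<longlongrightarrow> 0) at_top" if "s \<in> S" "(y \<longlongrightarrow> s) at_top" for y and s
    using tendsto_infdist[OF that(2), of S] that(1) by simp
  \<comment> \<open>Only convergence is kept here, so the radius 1 is arbitrary.\<close>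
  obtain W where W: "open W" "S \<subseteq> W" "\<And>T y. trajectory (Xsp F) T y \<Longrightarrow> y 0 \<in> W \<Longrightarrow>
      T = \<infinity> \<and> (\<exists>x\<in>S. (y \<longlongrightarrow> x) at_top)"
    using nbhd[of 1] by auto
  show ?thesis
    unfolding locally_asymptotically_stable_def trajectories_converge_to_point_in_def
  proof (intro conjI ballI allI impI)
    fix \<epsilon> :: real assume "\<epsilon> > 0"
    from nbhd[OF this] show "\<exists>W. open W \<and> S \<subseteq> W \<and> (\<forall>T y. trajectory (Xsp F) T y \<and> y 0 \<in> W \<longrightarrow>
        T = \<infinity> \<and> (\<forall>t\<ge>0. infdist (y t) S < \<epsilon>))"
      using near by meson
  next
    show "\<exists>W. open W \<and> S \<subseteq> W \<and> (\<forall>T y. trajectory (Xsp F) T y \<and> y 0 \<in> W \<longrightarrow>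
        T = \<infinity> \<and> ((\<lambda>t. infdist (y t) S) \<longlongrightarrow> 0) at_top)"
      using W conv by (intro exI[of _ W]) blast
  next
    show "\<exists>W. open W \<and> S \<subseteq> W \<and> (\<forall>T y. trajectory (Xsp F) T y \<and> y 0 \<in> W \<longrightarrow>
        T = \<infinity> \<and> (\<exists>s\<in>S. (y \<longlongrightarrow> s) at_top))"
      using W by (intro exI[of _ W]) blast
  qed (rule eq)
qed

end
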